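(* Let $\Gamma$ be any nontrivial additive subgroup of $\mathbb{C}$ and let $W=W(\Gamma)$ be the complex Lie algebra with basis $\{L_{\alpha,i}\mid \alpha\in\Gamma,\ i\in\mathbb{Z}_+\}$ and bracket $$[L_{\alpha,i},L_{\beta,j}]=(\beta-\alpha)L_{\alpha+\beta,i+j}+(j-i)L_{\alpha+\beta,i+j+1}\qquad(\alpha,\beta\in\Gamma,\ i,j\in\mathbb{Z}_+).$$ For $n\in\mathbb{Z}_+$ let $W^n=\mathrm{span}\{L_{\alpha,i}\mid\alpha\in\Gamma,\ i\ge n\}$. Then: (1) $W$ does not contain any nonzero $\mathrm{ad}$-locally finite element. (2) $W$ is not finitely graded. (3) The subspaces $W^n$ with $n\in\mathbb{Z}_+$ are all of the nonzero ideals of $W$ (thus $W^1$ is the unique maximal ideal of $W$). Furthermore, for all integers $0\le m\le n$, $$W^n=\mathrm{ad}_{W^1}^m(W^{n-m})=\underbrace{[W^1,[W^1,\ldots,[W^1}_{m},W^{n-m}]\ldots]].$$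
   Context: $\mathbb{Z}_+$ denotes the set of nonnegative integers. "Nontrivial" means $\Gamma\neq\{0\}$. For subspaces $A,B$ of a Lie algebra, $[A,B]$ is the linear span of all $[a,b]$ with $a\in A$, $b\in B$; for $m=0$, $\mathrm{ad}_{W^1}^0(W^n)=W^n$. An element $x$ of a Lie algebra $\mathcal{L}$ is $\mathrm{ad}$-locally finite if for every $y\in\mathcal{L}$ the subspace $\mathrm{span}\{\mathrm{ad}_x^i(y)\mid i\in\mathbb{Z}_+\}$ is finite-dimensional, where $\mathrm{ad}_x(y)=[x,y]$. A Lie algebra $\mathcal{L}$ is finitely graded if there exists an abelian group $G$ such that $\mathcal{L}=\bigoplus_{a\in G}\mathcal{L}_{[a]}$ is $G$-graded with $[\mathcal{L}_{[a]},\mathcal{L}_{[b]}]\subset\mathcal{L}_{[a+b]}$ and $\dim\mathcal{L}_{[a]}<\infty$ for all $a,b\in G$. *)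

theory Defs
  imports Complex_Main "HOL-Library.Poly_Mapping" "HOL-Algebra.Group"
begin

text \<open>A Lie algebra carried by the subspace \<open>V\<close> of an ambient vector space.\<close>

locale lie_algebra = vector_space scale
  for scale :: "'k::field \<Rightarrow> 'a::ab_group_add \<Rightarrow> 'a" +
  fixes V :: "'a set" and bracket :: "'a \<Rightarrow> 'a \<Rightarrow> 'a"
  assumes subspace_V: "subspace V"
    and bracket_closed: "\<lbrakk>x \<in> V; y \<in> V\<rbrakk> \<Longrightarrow> bracket x y \<in> V"
    and bracket_add_left:
      "\<lbrakk>x \<in> V; y \<in> V; z \<in> V\<rbrakk> \<Longrightarrow> bracket (x + y) z = bracket x z + bracket y z"
    and bracket_add_right:
      "\<lbrakk>x \<in> V; y \<in> V; z \<in> V\<rbrakk> \<Longrightarrow> bracket x (y + z) = bracket x y + bracket x z"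
    and bracket_scale_left:
      "\<lbrakk>x \<in> V; y \<in> V\<rbrakk> \<Longrightarrow> bracket (scale c x) y = scale c (bracket x y)"
    and bracket_scale_right:
      "\<lbrakk>x \<in> V; y \<in> V\<rbrakk> \<Longrightarrow> bracket x (scale c y) = scale c (bracket x y)"
    and bracket_self: "x \<in> V \<Longrightarrow> bracket x x = 0"
    and jacobi: "\<lbrakk>x \<in> V; y \<in> V; z \<in> V\<rbrakk> \<Longrightarrow>
      bracket x (bracket y z) + bracket y (bracket z x) + bracket z (bracket x y) = 0"
begin

definition finite_dim :: "'a set \<Rightarrow> bool" where
  "finite_dim S \<longleftrightarrow> (\<exists>B. finite B \<and> S = span B)"

definition bracket_space :: "'a set \<Rightarrow> 'a set \<Rightarrow> 'a set" where
  "bracket_space A B = span {bracket a b | a b. a \<in> A \<and> b \<in> B}"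

definition ad_locally_finite :: "'a \<Rightarrow> bool" where
  "ad_locally_finite x \<longleftrightarrow>
     x \<in> V \<and> (\<forall>y\<in>V. finite_dim (span {(bracket x ^^ i) y | i. True}))"

definition lie_ideal :: "'a set \<Rightarrow> bool" where
  "lie_ideal I \<longleftrightarrow> subspace I \<and> I \<subseteq> V \<and> (\<forall>x\<in>V. \<forall>y\<in>I. bracket x y \<in> I)"

definition maximal_lie_ideal :: "'a set \<Rightarrow> bool" where
  "maximal_lie_ideal I \<longleftrightarrow>
     lie_ideal I \<and> I \<noteq> V \<and> (\<forall>J. lie_ideal J \<and> I \<subseteq> J \<and> J \<noteq> V \<longrightarrow> J = I)"

definition is_direct_sum :: "'g set \<Rightarrow> ('g \<Rightarrow> 'a set) \<Rightarrow> bool" where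
  "is_direct_sum I U \<longleftrightarrow>
     (\<forall>a\<in>I. subspace (U a) \<and> U a \<subseteq> V) \<and>
     (\<forall>x\<in>V. \<exists>!f. (\<forall>a\<in>I. f a \<in> U a) \<and> (\<forall>a. a \<notin> I \<longrightarrow> f a = 0) \<and>
        finite {a. f a \<noteq> 0} \<and> x = (\<Sum>a | f a \<noteq> 0. f a))"

text \<open>HOL cannot quantify over all groups of all types inside a formula. The type argument
  fixes where the elements of the grading group live; a theorem refuting
  \<open>finitely_graded TYPE('g)\<close> for a type variable \<open>'g\<close> rules out every abelian group.
  The grading group is written multiplicatively.\<close>

definition finitely_graded :: "'g itself \<Rightarrow> bool" where
  "finitely_graded _ \<longleftrightarrow>
     (\<exists>(G :: 'g monoid) U. comm_group G \<and> is_direct_sum (carrier G) U \<and>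
        (\<forall>a\<in>carrier G. \<forall>b\<in>carrier G. bracket_space (U a) (U b) \<subseteq> U (a \<otimes>\<^bsub>G\<^esub> b)) \<and>
        (\<forall>a\<in>carrier G. finite_dim (U a)))"

end

text \<open>The ambient space is the complex vector space with basis indexed by all pairs
  \<open>(\<alpha>, i)\<close>; the algebra \<open>Walg \<Gamma>\<close> sits inside it as the span of the basis vectors with
  \<open>\<alpha> \<in> \<Gamma>\<close>.\<close>

type_synonym wspace = "(complex \<times> nat) \<Rightarrow>\<^sub>0 complex"

definition wscale :: "complex \<Rightarrow> wspace \<Rightarrow> wspace" where
  "wscale c = Poly_Mapping.map ((*) c)"

definition Lgen :: "complex \<Rightarrow> nat \<Rightarrow> wspace" where
  "Lgen \<alpha> i = Poly_Mapping.single (\<alpha>, i) 1"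

text \<open>The bilinear extension of the bracket of basis vectors.\<close>

definition wbracket :: "wspace \<Rightarrow> wspace \<Rightarrow> wspace" where
  "wbracket x y =
     (\<Sum>(\<alpha>, i)\<in>Poly_Mapping.keys x. \<Sum>(\<beta>, j)\<in>Poly_Mapping.keys y.
        wscale (Poly_Mapping.lookup x (\<alpha>, i) * Poly_Mapping.lookup y (\<beta>, j))
          (wscale (\<beta> - \<alpha>) (Lgen (\<alpha> + \<beta>) (i + j)) +
           wscale (of_nat j - of_nat i) (Lgen (\<alpha> + \<beta>) (i + j + 1))))"

lemma lookup_wscale [simp]:
  "Poly_Mapping.lookup (wscale c x) k = c * Poly_Mapping.lookup x k"
  by (simp add: wscale_def map.rep_eq when_def)

global_interpretation wvs: vector_space wscale
  by unfold_locales
    (auto intro!: poly_mapping_eqI simp: lookup_add algebra_simps)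

definition Walg :: "complex set \<Rightarrow> wspace set" where
  "Walg \<Gamma> = wvs.span {Lgen \<alpha> i | \<alpha> i. \<alpha> \<in> \<Gamma>}"

definition Wpow :: "complex set \<Rightarrow> nat \<Rightarrow> wspace set" where
  "Wpow \<Gamma> n = wvs.span {Lgen \<alpha> i | \<alpha> i. \<alpha> \<in> \<Gamma> \<and> n \<le> i}"

text \<open>The construction is the intended one: the vectors \<open>Lgen \<alpha> i\<close> are linearly independent,
  they have the stated brackets, and \<open>Walg \<Gamma>\<close> is a Lie algebra.\<close>

lemma inj_Lgen: "inj (\<lambda>(\<alpha>, i). Lgen \<alpha> i)"
  by (auto simp: inj_def Lgen_def dest!: arg_cong[where f=Poly_Mapping.keys])

lemma wbracket_Lgen:
  "wbracket (Lgen \<alpha> i) (Lgen \<beta> j) =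
     wscale (\<beta> - \<alpha>) (Lgen (\<alpha> + \<beta>) (i + j)) +
     wscale (of_nat j - of_nat i) (Lgen (\<alpha> + \<beta>) (i + j + 1))"
  by (simp add: wbracket_def Lgen_def)

lemma independent_Lgen: "wvs.independent {Lgen \<alpha> i | \<alpha> i. \<alpha> \<in> \<Gamma>}"
  unfolding wvs.independent_explicit_module
proof (intro allI impI)
  fix t u v
  assume t: "finite t" "t \<subseteq> {Lgen \<alpha> i | \<alpha> i. \<alpha> \<in> \<Gamma>}"
    and z: "(\<Sum>v\<in>t. wscale (u v) v) = 0" and v: "v \<in> t"
  obtain \<alpha> i where vi: "v = Lgen \<alpha> i" using t v by blast
  have "0 = Poly_Mapping.lookup (\<Sum>v\<in>t. wscale (u v) v) (\<alpha>, i)"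
    by (simp add: z)
  also have "\<dots> = (\<Sum>w\<in>t. if w = v then u v else 0)"
    unfolding lookup_sum
  proof (rule sum.cong)
    fix w assume "w \<in> t"
    then obtain \<beta> j where w: "w = Lgen \<beta> j" using t by blast
    show "Poly_Mapping.lookup (wscale (u w) w) (\<alpha>, i) = (if w = v then u v else 0)"
    proof (cases "w = v")
      case True
      then show ?thesis by (simp add: vi Lgen_def)
    next
      case False
      then have "(\<beta>, j) \<noteq> (\<alpha>, i)" by (auto simp: vi w)
      then show ?thesis using False by (simp add: w Lgen_def lookup_single_not_eq)
    qed
  qed simp
  also have "\<dots> = u v" using t v by simp
  finally show "u v = 0" by simp
qed

lemma span_Lgen: "x \<in> wvs.span {Lgen \<alpha> i | \<alpha> i. \<alpha> \<in> UNIV}"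
proof -
  have "x = (\<Sum>p\<in>Poly_Mapping.keys x. wscale (Poly_Mapping.lookup x p) (Lgen (fst p) (snd p)))"
    by (rule poly_mapping_eqI)
      (auto simp: lookup_sum Lgen_def lookup_single when_def if_distrib in_keys_iff cong: if_cong)
  also have "\<dots> \<in> wvs.span {Lgen \<alpha> i | \<alpha> i. \<alpha> \<in> UNIV}"
    by (intro wvs.span_sum wvs.span_scale wvs.span_base) auto
  finally show ?thesis .
qed

lemma wbracket_superset:
  assumes "finite A" "Poly_Mapping.keys x \<subseteq> A" "finite B" "Poly_Mapping.keys y \<subseteq> B"
  shows "wbracket x y = (\<Sum>p\<in>A. \<Sum>q\<in>B.
     wscale (Poly_Mapping.lookup x p * Poly_Mapping.lookup y q)
       (wbracket (Lgen (fst p) (snd p)) (Lgen (fst q) (snd q))))"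
proof -
  have "wbracket x y = (\<Sum>p\<in>Poly_Mapping.keys x. \<Sum>q\<in>Poly_Mapping.keys y.
     wscale (Poly_Mapping.lookup x p * Poly_Mapping.lookup y q)
       (wbracket (Lgen (fst p) (snd p)) (Lgen (fst q) (snd q))))"
    by (simp add: wbracket_def[of x y] wbracket_Lgen case_prod_beta)
  also have "\<dots> = (\<Sum>p\<in>Poly_Mapping.keys x. \<Sum>q\<in>B.
     wscale (Poly_Mapping.lookup x p * Poly_Mapping.lookup y q)
       (wbracket (Lgen (fst p) (snd p)) (Lgen (fst q) (snd q))))"
    using assms by (intro sum.cong refl sum.mono_neutral_left) (auto simp: in_keys_iff)
  also have "\<dots> = (\<Sum>p\<in>A. \<Sum>q\<in>B.
     wscale (Poly_Mapping.lookup x p * Poly_Mapping.lookup y q)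
       (wbracket (Lgen (fst p) (snd p)) (Lgen (fst q) (snd q))))"
    using assms by (intro sum.mono_neutral_left) (auto simp: in_keys_iff)
  finally show ?thesis .
qed

lemma wbracket_add_left: "wbracket (x + y) z = wbracket x z + wbracket y z"
proof -
  let ?A = "Poly_Mapping.keys x \<union> Poly_Mapping.keys y" and ?B = "Poly_Mapping.keys z"
  have "Poly_Mapping.keys (x + y) \<subseteq> ?A" by (rule keys_add)
  then show ?thesis
    by (simp add: wbracket_superset[of ?A "x + y" ?B z] wbracket_superset[of ?A x ?B z]
        wbracket_superset[of ?A y ?B z] lookup_add distrib_right wvs.scale_left_distrib
        sum.distrib)
qed

lemma wbracket_scale_left: "wbracket (wscale c x) y = wscale c (wbracket x y)"
proof -
  let ?A = "Poly_Mapping.keys x" and ?B = "Poly_Mapping.keys y"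
  have "Poly_Mapping.keys (wscale c x) \<subseteq> ?A" by (auto simp: in_keys_iff)
  then show ?thesis
    by (simp add: wbracket_superset[of ?A "wscale c x" ?B y] wbracket_superset[of ?A x ?B y] wvs.scale_sum_right mult.assoc)
qed

lemma wbracket_Lgen_anti: "wbracket (Lgen \<beta> j) (Lgen \<alpha> i) = - wbracket (Lgen \<alpha> i) (Lgen \<beta> j)"
  by (simp add: wbracket_Lgen add.commute wvs.scale_left_diff_distrib)

lemma wbracket_anti: "wbracket y x = - wbracket x y"
proof -
  let ?A = "Poly_Mapping.keys x" and ?B = "Poly_Mapping.keys y"
  have "wbracket y x = (\<Sum>p\<in>?B. \<Sum>q\<in>?A.
     - wscale (Poly_Mapping.lookup x q * Poly_Mapping.lookup y p)
       (wbracket (Lgen (fst q) (snd q)) (Lgen (fst p) (snd p))))"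
    by (subst wbracket_superset[of ?B _ ?A], simp_all,
        subst wbracket_Lgen_anti, simp add: mult.commute)
  also have "\<dots> = - wbracket x y"
    by (subst sum.swap) (simp add: wbracket_superset[of ?A x ?B y] sum_negf)
  finally show ?thesis .
qed

lemma wbracket_self: "wbracket x x = 0"
proof (rule poly_mapping_eqI)
  fix k
  have "Poly_Mapping.lookup (wbracket x x) k = - Poly_Mapping.lookup (wbracket x x) k"
    by (subst wbracket_anti) (rule lookup_uminus)
  then show "Poly_Mapping.lookup (wbracket x x) k = Poly_Mapping.lookup 0 k"
    by simp
qed

lemma wbracket_add_right: "wbracket x (y + z) = wbracket x y + wbracket x z"
  by (simp add: wbracket_anti[of x] wbracket_add_left)

lemma wbracket_scale_right: "wbracket x (wscale c y) = wscale c (wbracket x y)"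
  by (simp add: wbracket_anti[of x] wbracket_scale_left)

lemma wbracket_zero [simp]: "wbracket 0 x = 0" "wbracket x 0 = 0"
  using wbracket_scale_left[of 0 0 x] wbracket_scale_right[of x 0 0] by auto

lemma jacobi_Lgen:
  "wbracket (Lgen \<alpha> i) (wbracket (Lgen \<beta> j) (Lgen \<gamma> k)) +
   wbracket (Lgen \<beta> j) (wbracket (Lgen \<gamma> k) (Lgen \<alpha> i)) +
   wbracket (Lgen \<gamma> k) (wbracket (Lgen \<alpha> i) (Lgen \<beta> j)) = 0"
proof -
  define A where "A = Lgen (\<alpha> + \<beta> + \<gamma>) (i + j + k)"
  define B where "B = Lgen (\<alpha> + \<beta> + \<gamma>) (i + j + k + 1)"
  define C where "C = Lgen (\<alpha> + \<beta> + \<gamma>) (i + j + k + 2)"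
  have "Lgen (\<alpha> + (\<beta> + \<gamma>)) (i + (j + k)) = A" "Lgen (\<beta> + (\<gamma> + \<alpha>)) (j + (k + i)) = A"
    "Lgen (\<gamma> + (\<alpha> + \<beta>)) (k + (i + j)) = A"
    "Lgen (\<alpha> + (\<beta> + \<gamma>)) (i + (j + k) + 1) = B" "Lgen (\<beta> + (\<gamma> + \<alpha>)) (j + (k + i) + 1) = B"
    "Lgen (\<gamma> + (\<alpha> + \<beta>)) (k + (i + j) + 1) = B"
    "Lgen (\<alpha> + (\<beta> + \<gamma>)) (i + (j + k + 1)) = B" "Lgen (\<beta> + (\<gamma> + \<alpha>)) (j + (k + i + 1)) = B"
    "Lgen (\<gamma> + (\<alpha> + \<beta>)) (k + (i + j + 1)) = B"
    "Lgen (\<alpha> + (\<beta> + \<gamma>)) (i + (j + k + 1) + 1) = C" "Lgen (\<beta> + (\<gamma> + \<alpha>)) (j + (k + i + 1) + 1) = C"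
    "Lgen (\<gamma> + (\<alpha> + \<beta>)) (k + (i + j + 1) + 1) = C"
    by (simp_all add: A_def B_def C_def ac_simps)
  note L = this
  show ?thesis
    unfolding wbracket_Lgen wbracket_add_right wbracket_scale_right L
    by (rule poly_mapping_eqI) (simp add: lookup_add algebra_simps)
qed

lemma subspace_jacobi: "wvs.subspace {x. wbracket x (wbracket y z) + wbracket y (wbracket z x) + wbracket z (wbracket x y) = 0}"
proof (rule wvs.subspaceI)
  fix a b
  assume "a \<in> {x. wbracket x (wbracket y z) + wbracket y (wbracket z x) + wbracket z (wbracket x y) = 0}"
    and "b \<in> {x. wbracket x (wbracket y z) + wbracket y (wbracket z x) + wbracket z (wbracket x y) = 0}"
  then have "(wbracket a (wbracket y z) + wbracket y (wbracket z a) + wbracket z (wbracket a y))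
    + (wbracket b (wbracket y z) + wbracket y (wbracket z b) + wbracket z (wbracket b y)) = 0"
    by simp
  then show "a + b \<in> {x. wbracket x (wbracket y z) + wbracket y (wbracket z x) + wbracket z (wbracket x y) = 0}"
    by (simp add: wbracket_add_left wbracket_add_right ac_simps)
next
  fix c a
  assume "a \<in> {x. wbracket x (wbracket y z) + wbracket y (wbracket z x) + wbracket z (wbracket x y) = 0}"
  then have "wscale c (wbracket a (wbracket y z) + wbracket y (wbracket z a) + wbracket z (wbracket a y)) = 0"
    by simp
  then show "wscale c a \<in> {x. wbracket x (wbracket y z) + wbracket y (wbracket z x) + wbracket z (wbracket x y) = 0}"
    by (simp add: wbracket_scale_left wbracket_scale_right wvs.scale_right_distrib)
qed simp

lemma wbracket_jacobi:
  "wbracket x (wbracket y z) + wbracket y (wbracket z x) + wbracket z (wbracket x y) = 0"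
proof -
  let ?J = "\<lambda>x y z. wbracket x (wbracket y z) + wbracket y (wbracket z x) + wbracket z (wbracket x y)"
  have rot: "?J x y z = ?J y z x" for x y z by (simp add: ac_simps)
  have 1: "?J x (Lgen \<beta> j) (Lgen \<gamma> k) = 0" for x \<beta> j \<gamma> k
    by (rule wvs.span_induct[OF span_Lgen[of x] subspace_jacobi]) (auto simp: jacobi_Lgen)
  have 2: "?J x y (Lgen \<gamma> k) = 0" for x y \<gamma> k
  proof -
    have "?J (Lgen \<beta> j) (Lgen \<gamma> k) x = 0" for \<beta> j
      using 1[of x \<beta> j \<gamma> k] by (simp only: rot[of x "Lgen \<beta> j" "Lgen \<gamma> k"])
    then have "?J y (Lgen \<gamma> k) x = 0"
      by (intro wvs.span_induct[OF span_Lgen[of y] subspace_jacobi]) blast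
    then show ?thesis by (simp only: rot[of x y "Lgen \<gamma> k"])
  qed
  have "?J (Lgen \<gamma> k) x y = 0" for \<gamma> k
    using 2[of x y \<gamma> k] by (simp only: rot[of "Lgen \<gamma> k" x y])
  then have "?J z x y = 0"
    by (intro wvs.span_induct[OF span_Lgen[of z] subspace_jacobi]) blast
  then show ?thesis by (simp only: rot[of z x y])
qed

lemma lie_algebra_Walg:
  assumes "\<And>a b. a \<in> \<Gamma> \<Longrightarrow> b \<in> \<Gamma> \<Longrightarrow> a + b \<in> \<Gamma>"
  shows "lie_algebra wscale (Walg \<Gamma>) wbracket"
proof unfold_locales
  show "wvs.subspace (Walg \<Gamma>)" by (simp add: Walg_def)
next
  fix x y assume x: "x \<in> Walg \<Gamma>" and y: "y \<in> Walg \<Gamma>"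
  have sub: "wvs.subspace {u. wbracket u v \<in> Walg \<Gamma>}" for v
    by (rule wvs.subspaceI)
      (auto simp: wbracket_add_left wbracket_scale_left Walg_def wvs.span_add wvs.span_scale wvs.span_zero)
  have sub': "wvs.subspace {u. wbracket v u \<in> Walg \<Gamma>}" for v
    by (rule wvs.subspaceI)
      (auto simp: wbracket_add_right wbracket_scale_right Walg_def wvs.span_add wvs.span_scale wvs.span_zero)
  have base: "wbracket (Lgen \<alpha> i) (Lgen \<beta> j) \<in> Walg \<Gamma>" if "\<alpha> \<in> \<Gamma>" "\<beta> \<in> \<Gamma>" for \<alpha> \<beta> i j
    unfolding wbracket_Lgen Walg_def
    using assms[OF that] by (intro wvs.span_add wvs.span_scale wvs.span_base) auto
  have 1: "wbracket (Lgen \<alpha> i) y \<in> Walg \<Gamma>" if "\<alpha> \<in> \<Gamma>" for \<alpha> i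
    by (rule wvs.span_induct[OF y[unfolded Walg_def] sub']) (use base that in auto)
  show "wbracket x y \<in> Walg \<Gamma>"
    by (rule wvs.span_induct[OF x[unfolded Walg_def] sub]) (use 1 in auto)
qed (simp_all add: wbracket_add_left wbracket_add_right wbracket_scale_left
    wbracket_scale_right wbracket_self wbracket_jacobi)

end

(*
  In the commutative ring A spanned by the Lgen \<alpha> i, with Lgen \<alpha> i * Lgen \<beta> j = Lgen (\<alpha> + \<beta>) (i + j),
  let D = [1, _]. Then D is a derivation and [x, y] = x * D y - y * D x.

  (1), (2) If the t-degree (the largest second index) of y exceeds that of x \<noteq> 0, then [x, y] has
  t-degree tdeg x + tdeg y + 1. So iterating ad x leaves every finite-dimensional subspace, and so
  does iterating a composition of adjoint maps of homogeneous elements.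

  (3) A second difference of double brackets shows that every ideal of the Lie algebra is an ideal
  of A. Brackets then reduce a nonzero element of the ideal to a single Lgen 0 M, and the least
  such M determines the ideal.
*)

theory Submission
  imports Defs "HOL-Library.Product_Plus"
begin

text \<open>Think of \<open>Lgen \<alpha> i\<close> as exp(\<alpha> x) t^i with t = -1/x. Then t' =
  t^2, D is d/dx, and W is the Lie algebra of vector fields f d/dx with f in A. The obstacle
  throughout is that both structure constants \<beta> - \<alpha> and j - i can vanish, so an extreme
  term of a bracket is not automatically nonzero. Each nonvanishing argument picks the extreme index
  at which one constant is known to survive: the highest second indices when the degrees differ, the
  lowest ones when the first indices differ. When leading terms from several first indices meet, a
  total order on the complex numbers that is compatible with addition keeps one of them from
  cancelling. The grading group in (2) has no given relation to \<Gamma> and may have torsion, so it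
  offers no leading degree; the order used on it is the one forced by the degree growth of adjoint
  maps.\<close>

lemma wspace_induct [case_names gen add scale]:
  assumes "\<And>\<alpha> i. P (Lgen \<alpha> i)"
    and "\<And>x y. P x \<Longrightarrow> P y \<Longrightarrow> P (x + y)"
    and "\<And>c x. P x \<Longrightarrow> P (wscale c x)"
  shows "P x"
proof (rule wvs.span_induct[OF span_Lgen[of x]])
  \<comment> \<open>The zero vector needs no case of its own: it is 0 times a generator.\<close>
  have "P (wscale 0 (Lgen 0 0))" using assms by blast
  then show "wvs.subspace (Collect P)"
    using assms(2,3) by (intro wvs.subspaceI) auto
qed (use assms(1) in auto)

section \<open>The commutative ring and its derivation\<close>

text \<open>The product is the convolution that \<open>poly_mapping\<close> carries, with index
  pairs added componentwise.\<close>

lemma Lgen_mult: "Lgen \<alpha> i * Lgen \<beta> j = Lgen (\<alpha> + \<beta>) (i + j)"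
  by (simp add: Lgen_def mult_single)

lemma Lgen_0_0: "Lgen 0 0 = 1"
  by (simp add: Lgen_def flip: zero_prod_def)

lemma wscale_conv_mult: "wscale c x = Poly_Mapping.single 0 c * x"
  by (simp add: wscale_def mult_map_scale_conv_mult)

lemma wscale_mult_left: "wscale c x * y = wscale c (x * y)"
  by (simp add: wscale_conv_mult mult.assoc)

lemma wscale_mult_right: "x * wscale c y = wscale c (x * y)"
  by (simp add: wscale_conv_mult mult.left_commute)

lemma wbracket_one_Lgen:
  "wbracket 1 (Lgen \<alpha> i) = wscale \<alpha> (Lgen \<alpha> i) + wscale (of_nat i) (Lgen \<alpha> (Suc i))"
  using wbracket_Lgen[of 0 0 \<alpha> i] by (simp add: Lgen_0_0)

lemma wbracket_one_mult: "wbracket 1 (x * y) = x * wbracket 1 y + wbracket 1 x * y"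
proof (induction x rule: wspace_induct)
  case (gen \<alpha> i)
  show ?case
  proof (induction y rule: wspace_induct)
    case (gen \<beta> j)
    show ?case
      by (simp add: Lgen_mult wbracket_one_Lgen distrib_left distrib_right wscale_mult_left
          wscale_mult_right wvs.scale_left_distrib)
  qed (simp_all add: wbracket_add_right wbracket_scale_right distrib_left distrib_right
      wscale_mult_left wscale_mult_right wvs.scale_right_distrib)
qed (simp_all add: wbracket_add_right wbracket_scale_right distrib_left distrib_right
    wscale_mult_left wscale_mult_right wvs.scale_right_distrib)

text \<open>This is the bracket of the vector fields x D and y D. Both sides are bilinear, so
  generators suffice; there D y supplies the factors \<beta> and j, and D x supplies \<alpha> and
  i.\<close>

lemma wbracket_conv_mult: "wbracket x y = x * wbracket 1 y - y * wbracket 1 x"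
proof (induction x rule: wspace_induct)
  case (gen \<alpha> i)
  show ?case
  proof (induction y rule: wspace_induct)
    case (gen \<beta> j)
    show ?case
      by (simp add: Lgen_mult wbracket_Lgen wbracket_one_Lgen distrib_left wscale_mult_right
          wvs.scale_left_diff_distrib ac_simps)
  qed (simp_all add: wbracket_add_right wbracket_scale_right distrib_left distrib_right
      wscale_mult_left wscale_mult_right wvs.scale_right_diff_distrib)
qed (simp_all add: wbracket_add_left wbracket_add_right wbracket_scale_left wbracket_scale_right
    distrib_left distrib_right wscale_mult_left wscale_mult_right wvs.scale_right_diff_distrib)

lemma wbracket_diff_right: "wbracket x (y - z) = wbracket x y - wbracket x z"
  using wbracket_add_right[of x "y - z" z] by (simp add: algebra_simps)

lemma wbracket_sum_left: "wbracket (\<Sum>a\<in>A. f a) y = (\<Sum>a\<in>A. wbracket (f a) y)"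
  by (induction A rule: infinite_finite_induct) (simp_all add: wbracket_add_left)

lemma wbracket_sum_right: "wbracket x (\<Sum>a\<in>A. f a) = (\<Sum>a\<in>A. wbracket x (f a))"
  by (induction A rule: infinite_finite_induct) (simp_all add: wbracket_add_right)

text \<open>With g in place of h, the first double bracket is \<open>Lgen \<delta> k\<close> times a
  quadratic polynomial in g whose g^2 coefficient is -2 f. The three terms are its values at h, -h
  and 0. The second difference cancels all terms that are constant or linear in g, in particular
  those with D f and D (D f), and leaves 2 * (-2) * h^2 = -4 h^2 times f.\<close>

lemma wbracket_second_difference:
  "wbracket (Lgen (\<delta> - h) k) (wbracket (Lgen h 0) f)
   + wbracket (Lgen (\<delta> + h) k) (wbracket (Lgen (- h) 0) f)
   - wscale 2 (wbracket (Lgen \<delta> k) (wbracket (Lgen 0 0) f))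
   = wscale (- 4 * h\<^sup>2) (Lgen \<delta> k * f)"
proof -
  \<comment> \<open>Scalars become ring elements, so that the claim is an identity in a commutative
    ring, open to \<open>algebra_simps\<close>.\<close>
  define K :: "complex \<Rightarrow> wspace" where "K = Poly_Mapping.single 0"
  have K: "wscale c x = K c * x" for c x by (simp add: K_def wscale_conv_mult)
  have Ka: "K (a + b) = K a + K b" "K (a * b) = K a * K b" "K (- a) = - K a" 
    "K (a - b) = K a - K b" "K 0 = 0" "K 1 = 1" for a b
    by (simp_all add: K_def single_add mult_single single_uminus single_diff)
  define t where "t = Lgen 0 1"
  have DL: "wbracket 1 (Lgen \<alpha> i) = (K \<alpha> + K (of_nat i) * t) * Lgen \<alpha> i" for \<alpha> i
    using Lgen_mult[of 0 1 \<alpha> i]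
    by (simp add: wbracket_one_Lgen K t_def distrib_right mult.assoc)
  \<comment> \<open>\<open>Lgen \<delta> k\<close> factors as
    \<open>Lgen (\<delta> - g) k * Lgen g 0\<close>, so it can be pulled out whatever g is; what
    remains is a polynomial in g.\<close>
  have E: "wbracket (Lgen (\<delta> - g) k) (wbracket (Lgen g 0) f) =
     Lgen \<delta> k * (wbracket 1 (wbracket 1 f) - (K \<delta> + K (of_nat k) * t - K g) * wbracket 1 f
       - (K g + K g - K \<delta> - K (of_nat k) * t) * K g * f)" for g
  proof -
    have L: "Lgen \<delta> k = Lgen (\<delta> - g) k * Lgen g 0" by (simp add: Lgen_mult)
    have DK: "wbracket 1 (K c) = 0" for c
      using wbracket_scale_right[of 1 c 1] by (simp add: K wbracket_self)
    have eq1: "wbracket (Lgen g 0) f = Lgen g 0 * (wbracket 1 f - K g * f)"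
      by (simp add: wbracket_conv_mult[of "Lgen g 0"] DL Ka algebra_simps)
    have eq2: "wbracket 1 (Lgen g 0 * (wbracket 1 f - K g * f)) =
      Lgen g 0 * (wbracket 1 (wbracket 1 f) - K g * wbracket 1 f)
       + K g * Lgen g 0 * (wbracket 1 f - K g * f)"
      by (simp add: wbracket_one_mult DL Ka DK wbracket_diff_right)
    show ?thesis
      unfolding wbracket_conv_mult[of "Lgen (\<delta> - g) k"] eq1 eq2 L
      by (simp add: DL Ka algebra_simps)
  qed
  \<comment> \<open>The numeral is spelled out in ones because \<open>Ka\<close> moves
    \<open>K\<close> only through ring operations, 0 and 1.\<close>
  have "- 4 * h\<^sup>2 = - ((1 + 1 + 1 + 1) * h * h)"
    by (simp add: power2_eq_square)
  then have "K (- 4 * h\<^sup>2) = - ((1 + 1 + 1 + 1) * K h * K h)"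
    by (simp only: Ka)
  note K4 = this
  have K2: "K 2 = 1 + 1" using Ka(1)[of 1 1] Ka(6) by simp
  have Eh: "wbracket (Lgen (\<delta> + h) k) (wbracket (Lgen (- h) 0) f) =
     Lgen \<delta> k * (wbracket 1 (wbracket 1 f) - (K \<delta> + K (of_nat k) * t + K h) * wbracket 1 f
       + (- K h - K h - K \<delta> - K (of_nat k) * t) * K h * f)"
    using E[of "- h"] by (simp add: Ka)
  have E0: "wbracket (Lgen \<delta> k) (wbracket (Lgen 0 0) f) =
     Lgen \<delta> k * (wbracket 1 (wbracket 1 f) - (K \<delta> + K (of_nat k) * t) * wbracket 1 f)"
    using E[of 0] by (simp add: Ka)
  show ?thesis
    unfolding E Eh E0 K K4 K2 by (simp add: Ka(6) algebra_simps)
qed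


section \<open>Coefficients\<close>

lemma lookup_Lgen: "Poly_Mapping.lookup (Lgen \<alpha> i) r = (if r = (\<alpha>, i) then 1 else 0)"
  by (simp add: Lgen_def lookup_single when_def)

lemma keys_Lgen [simp]: "Poly_Mapping.keys (Lgen \<alpha> i) = {(\<alpha>, i)}"
  by (simp add: Lgen_def)

lemma keys_wscale: "Poly_Mapping.keys (wscale c x) = (if c = 0 then {} else Poly_Mapping.keys x)"
  by (auto simp: in_keys_iff)

text \<open>Both \<open>Wpow\<close> and the degree bounds are support conditions of this kind, so a
  span inherits them from its generators.\<close>

lemma subspace_keys: "wvs.subspace {x. Poly_Mapping.keys x \<subseteq> A}"
proof (rule wvs.subspaceI)
  show "x + y \<in> {x. Poly_Mapping.keys x \<subseteq> A}"
    if "x \<in> {x. Poly_Mapping.keys x \<subseteq> A}" "y \<in> {x. Poly_Mapping.keys x \<subseteq> A}" for x y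
    using that keys_add[of x y] by auto
qed (auto simp: keys_wscale)

lemma wspace_expand:
  "(\<Sum>p\<in>Poly_Mapping.keys x. wscale (Poly_Mapping.lookup x p) (Lgen (fst p) (snd p))) = x"
  by (rule poly_mapping_eqI)
    (auto simp: lookup_sum lookup_Lgen in_keys_iff if_distrib cong: if_cong)

lemma lookup_wbracket:
  "Poly_Mapping.lookup (wbracket x y) r = (\<Sum>p\<in>Poly_Mapping.keys x. \<Sum>q\<in>Poly_Mapping.keys y.
     Poly_Mapping.lookup x p * Poly_Mapping.lookup y q *
     Poly_Mapping.lookup (wbracket (Lgen (fst p) (snd p)) (Lgen (fst q) (snd q))) r)"
  by (subst wbracket_superset[of "Poly_Mapping.keys x" x "Poly_Mapping.keys y" y])
    (simp_all add: lookup_sum)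

lemma keys_wbracketE:
  assumes "r \<in> Poly_Mapping.keys (wbracket x y)"
  obtains p q where "p \<in> Poly_Mapping.keys x" "q \<in> Poly_Mapping.keys y"
    "r \<in> Poly_Mapping.keys (wbracket (Lgen (fst p) (snd p)) (Lgen (fst q) (snd q)))"
proof -
  have "Poly_Mapping.lookup (wbracket x y) r \<noteq> 0"
    using assms by (simp add: in_keys_iff)
  then obtain p where p: "p \<in> Poly_Mapping.keys x" and "(\<Sum>q\<in>Poly_Mapping.keys y.
     Poly_Mapping.lookup x p * Poly_Mapping.lookup y q *
     Poly_Mapping.lookup (wbracket (Lgen (fst p) (snd p)) (Lgen (fst q) (snd q))) r) \<noteq> 0"
    unfolding lookup_wbracket[of x y r] by (rule sum.not_neutral_contains_not_neutral)
  then obtain q where "q \<in> Poly_Mapping.keys y"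
    "Poly_Mapping.lookup x p * Poly_Mapping.lookup y q *
     Poly_Mapping.lookup (wbracket (Lgen (fst p) (snd p)) (Lgen (fst q) (snd q))) r \<noteq> 0"
    by (elim sum.not_neutral_contains_not_neutral)
  then show thesis using that[of p q] p by (simp add: in_keys_iff)
qed

lemma keys_wbracket_LgenD:
  assumes "r \<in> Poly_Mapping.keys (wbracket (Lgen \<alpha> i) (Lgen \<beta> j))"
  shows "fst r = \<alpha> + \<beta>" "snd r = i + j \<or> snd r = i + j + 1"
  using assms by (auto simp: in_keys_iff wbracket_Lgen lookup_add lookup_Lgen split: if_splits)

text \<open>Brackets are shown to be nonzero by choosing an index r that only one pair of basis
  vectors reaches; then no cancellation can occur at r.\<close>

lemma lookup_wbracket_single:
  assumes "(\<alpha>, i) \<in> Poly_Mapping.keys x" "(\<beta>, j) \<in> Poly_Mapping.keys y"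
    and "\<And>p' q'. p' \<in> Poly_Mapping.keys x \<Longrightarrow> q' \<in> Poly_Mapping.keys y \<Longrightarrow> (p', q') \<noteq> ((\<alpha>, i), (\<beta>, j)) \<Longrightarrow>
      Poly_Mapping.lookup (wbracket (Lgen (fst p') (snd p')) (Lgen (fst q') (snd q'))) r = 0"
  shows "Poly_Mapping.lookup (wbracket x y) r =
    Poly_Mapping.lookup x (\<alpha>, i) * Poly_Mapping.lookup y (\<beta>, j) *
     Poly_Mapping.lookup (wbracket (Lgen \<alpha> i) (Lgen \<beta> j)) r"
proof -
  let ?c = "\<lambda>p q. Poly_Mapping.lookup x p * Poly_Mapping.lookup y q *
     Poly_Mapping.lookup (wbracket (Lgen (fst p) (snd p)) (Lgen (fst q) (snd q))) r"
  let ?S = "{((\<alpha>, i), (\<beta>, j))}"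
  have "Poly_Mapping.lookup (wbracket x y) r =
    (\<Sum>(p', q')\<in>Poly_Mapping.keys x \<times> Poly_Mapping.keys y. ?c p' q')"
    by (simp only: lookup_wbracket[of x y r] sum.cartesian_product)
  also have "\<dots> = (\<Sum>(p', q')\<in>?S. ?c p' q')"
  proof (rule sum.mono_neutral_right)
    show "\<forall>pq\<in>Poly_Mapping.keys x \<times> Poly_Mapping.keys y - ?S.
      (case pq of (p', q') \<Rightarrow> ?c p' q') = 0"
    proof
      fix pq assume "pq \<in> Poly_Mapping.keys x \<times> Poly_Mapping.keys y - ?S"
      then show "(case pq of (p', q') \<Rightarrow> ?c p' q') = 0"
        using assms(3)[of "fst pq" "snd pq"] by (cases pq) simp
    qed
  qed (use assms(1,2) in auto)
  finally show ?thesis by simp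
qed

lemma lookup_wbracket_one:
  "Poly_Mapping.lookup (wbracket 1 x) (\<beta>, k) = \<beta> * Poly_Mapping.lookup x (\<beta>, k) +
     (if k = 0 then 0 else of_nat (k - 1) * Poly_Mapping.lookup x (\<beta>, k - 1))"
  by (induction x rule: wspace_induct)
    (auto simp: wbracket_one_Lgen lookup_Lgen lookup_add wbracket_add_right
      wbracket_scale_right algebra_simps)

lemma lookup_Lgen_mult:
  "Poly_Mapping.lookup (Lgen \<alpha> i * x) (\<alpha> + \<beta>, i + j) = Poly_Mapping.lookup x (\<beta>, j)"
  by (induction x rule: wspace_induct)
    (auto simp: Lgen_mult lookup_Lgen lookup_add distrib_left wscale_mult_right)

lemma keys_Lgen_mult:
  "Poly_Mapping.keys (Lgen \<alpha> i * x) = (\<lambda>p. (\<alpha> + fst p, i + snd p)) ` Poly_Mapping.keys x"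
proof
  show "Poly_Mapping.keys (Lgen \<alpha> i * x) \<subseteq> (\<lambda>p. (\<alpha> + fst p, i + snd p)) ` Poly_Mapping.keys x"
    using keys_mult[of "Lgen \<alpha> i" x] by (force simp: plus_prod_def)
qed (auto simp: in_keys_iff lookup_Lgen_mult)

lemma nonzero_keyE:
  assumes "f \<noteq> (0 :: wspace)"
  obtains \<alpha> i where "(\<alpha>, i) \<in> Poly_Mapping.keys f"
proof -
  have "Poly_Mapping.keys f \<noteq> {}" using assms by simp
  then obtain q where "q \<in> Poly_Mapping.keys f" by blast
  then show thesis using that[of "fst q" "snd q"] by simp
qed

text \<open>A coordinate projection, applied to columns (fixed first index) and to layers (fixed
  second index).\<close>

definition wrestrict :: "(complex \<times> nat) set \<Rightarrow> wspace \<Rightarrow> wspace" where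
  "wrestrict A x = (\<Sum>p\<in>Poly_Mapping.keys x \<inter> A.
     wscale (Poly_Mapping.lookup x p) (Lgen (fst p) (snd p)))"

lemma lookup_wrestrict:
  "Poly_Mapping.lookup (wrestrict A x) r = (if r \<in> A then Poly_Mapping.lookup x r else 0)"
  by (auto simp: wrestrict_def lookup_sum lookup_Lgen in_keys_iff if_distrib cong: if_cong)

lemma keys_wrestrict: "Poly_Mapping.keys (wrestrict A x) = Poly_Mapping.keys x \<inter> A"
  by (auto simp: in_keys_iff lookup_wrestrict split: if_splits)

lemma wrestrict_compl: "x - wrestrict A x = wrestrict (- A) x"
  by (rule poly_mapping_eqI) (auto simp: lookup_minus lookup_wrestrict)

section \<open>Membership in W and W^n through supports\<close>

lemma Lgen_in_Wpow: "\<alpha> \<in> \<Gamma> \<Longrightarrow> n \<le> i \<Longrightarrow> Lgen \<alpha> i \<in> Wpow \<Gamma> n"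
  unfolding Wpow_def by (intro wvs.span_base) auto

lemma Wpow_iff: "x \<in> Wpow \<Gamma> n \<longleftrightarrow> Poly_Mapping.keys x \<subseteq> \<Gamma> \<times> {n..}"
proof
  assume "x \<in> Wpow \<Gamma> n"
  then show "Poly_Mapping.keys x \<subseteq> \<Gamma> \<times> {n..}"
    unfolding Wpow_def by (rule wvs.span_induct[OF _ subspace_keys]) auto
next
  assume keys: "Poly_Mapping.keys x \<subseteq> \<Gamma> \<times> {n..}"
  have "Lgen (fst p) (snd p) \<in> Wpow \<Gamma> n" if "p \<in> Poly_Mapping.keys x" for p
  proof -
    have "fst p \<in> \<Gamma>" "n \<le> snd p" using keys that by auto
    then show ?thesis by (rule Lgen_in_Wpow)
  qed
  then have "(\<Sum>p\<in>Poly_Mapping.keys x. wscale (Poly_Mapping.lookup x p) (Lgen (fst p) (snd p)))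
      \<in> Wpow \<Gamma> n"
    unfolding Wpow_def by (intro wvs.span_sum wvs.span_scale)
  then show "x \<in> Wpow \<Gamma> n" by (simp only: wspace_expand)
qed

lemma Walg_conv_Wpow: "Walg \<Gamma> = Wpow \<Gamma> 0"
  by (simp add: Walg_def Wpow_def)

lemma Walg_iff: "x \<in> Walg \<Gamma> \<longleftrightarrow> fst ` Poly_Mapping.keys x \<subseteq> \<Gamma>"
  by (auto simp: Walg_conv_Wpow Wpow_iff)

section \<open>The degree in the second index\<close>

text \<open>The inserted 0 gives the zero vector degree 0, so a positive degree already implies a
  nonzero vector.\<close>

definition tdeg :: "wspace \<Rightarrow> nat" where
  "tdeg x = Max (insert 0 (snd ` Poly_Mapping.keys x))"

lemma tdeg_le_iff: "tdeg x \<le> n \<longleftrightarrow> Poly_Mapping.keys x \<subseteq> UNIV \<times> {..n}"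
  by (auto simp: tdeg_def)

lemma snd_le_tdeg: "p \<in> Poly_Mapping.keys x \<Longrightarrow> snd p \<le> tdeg x"
  by (auto simp: tdeg_def)

lemma tdeg_Lgen [simp]: "tdeg (Lgen \<alpha> i) = i"
  by (simp add: tdeg_def)

lemma tdeg_attained:
  assumes "x \<noteq> 0"
  obtains \<alpha> where "(\<alpha>, tdeg x) \<in> Poly_Mapping.keys x"
proof -
  have ne: "snd ` Poly_Mapping.keys x \<noteq> {}" using assms by simp
  then have "tdeg x = Max (snd ` Poly_Mapping.keys x)"
    by (simp add: tdeg_def)
  then have "tdeg x \<in> snd ` Poly_Mapping.keys x"
    using ne Max_in[of "snd ` Poly_Mapping.keys x"] by simp
  then show thesis using that by auto
qed

text \<open>It is through this bound that finite dimension is contradicted in (1) and (2).\<close>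

lemma span_tdeg_bounded:
  assumes "finite B"
  obtains N where "\<And>x. x \<in> wvs.span B \<Longrightarrow> tdeg x \<le> N"
proof
  let ?N = "Max (insert 0 (tdeg ` B))"
  have "B \<subseteq> {x. Poly_Mapping.keys x \<subseteq> UNIV \<times> {..?N}}"
    using assms by (auto simp flip: tdeg_le_iff)
  then have "wvs.span B \<subseteq> {x. Poly_Mapping.keys x \<subseteq> UNIV \<times> {..?N}}"
    by (rule wvs.span_minimal[OF _ subspace_keys])
  then show "tdeg x \<le> ?N" if "x \<in> wvs.span B" for x
    using that unfolding tdeg_le_iff by blast
qed

text \<open>Take the lexicographic maximum of each set, with real parts compared first.\<close>

lemma unique_sum_complex:
  fixes A B :: "complex set"
  assumes "finite A" "A \<noteq> {}" "finite B" "B \<noteq> {}"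
  obtains a b where "a \<in> A" "b \<in> B"
    "\<And>a' b'. a' \<in> A \<Longrightarrow> b' \<in> B \<Longrightarrow> a' + b' = a + b \<Longrightarrow> a' = a \<and> b' = b"
proof -
  have max: "\<exists>a\<in>A. \<forall>a'\<in>A. Re a' \<le> Re a \<and> (Re a' = Re a \<longrightarrow> Im a' \<le> Im a)"
    if "finite A" "A \<noteq> {}" for A :: "complex set"
  proof -
    let ?R = "Max (Re ` A)"
    let ?A = "{a \<in> A. Re a = ?R}"
    have "?R \<in> Re ` A" using that by (intro Max_in) auto
    then obtain a0 where "?R = Re a0" "a0 \<in> A" by (rule imageE)
    then have "finite ?A" "?A \<noteq> {}" using that by auto
    then have "Max (Im ` ?A) \<in> Im ` ?A" by (intro Max_in) auto
    then obtain a where a: "Max (Im ` ?A) = Im a" "a \<in> ?A" by (rule imageE)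
    have "Re a' \<le> Re a \<and> (Re a' = Re a \<longrightarrow> Im a' \<le> Im a)" if "a' \<in> A" for a'
    proof
      show "Re a' \<le> Re a" using a \<open>finite A\<close> that by simp
      show "Re a' = Re a \<longrightarrow> Im a' \<le> Im a"
      proof
        assume "Re a' = Re a"
        then have "a' \<in> ?A" using a(2) that by simp
        then show "Im a' \<le> Im a" unfolding a(1)[symmetric] using \<open>finite ?A\<close> by (intro Max_ge) auto
      qed
    qed
    then show ?thesis using a by blast
  qed
  obtain a where a: "a \<in> A" "\<forall>a'\<in>A. Re a' \<le> Re a \<and> (Re a' = Re a \<longrightarrow> Im a' \<le> Im a)"
    using max[OF assms(1,2)] by blast
  obtain b where b: "b \<in> B" "\<forall>b'\<in>B. Re b' \<le> Re b \<and> (Re b' = Re b \<longrightarrow> Im b' \<le> Im b)"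
    using max[OF assms(3,4)] by blast
  show thesis
  proof (rule that[OF a(1) b(1)])
    fix a' b' assume *: "a' \<in> A" "b' \<in> B" "a' + b' = a + b"
    have sums: "Re a' + Re b' = Re a + Re b" "Im a' + Im b' = Im a + Im b"
      using *(3) by (simp_all flip: plus_complex.sel)
    have le: "Re a' \<le> Re a" "Re b' \<le> Re b" using a b * by auto
    then have re: "Re a' = Re a" "Re b' = Re b" using sums by linarith+
    then have "Im a' \<le> Im a" "Im b' \<le> Im b" using a b * by auto
    then have "Im a' = Im a" "Im b' = Im b" using sums by linarith+
    then show "a' = a \<and> b' = b" using re by (simp add: complex_eq_iff)
  qed
qed

text \<open>Among the first indices of the top-degree terms of x and of y, some a and b have a sum
  that no other pair attains. At first index a + b and second index
  \<open>tdeg x + tdeg y + 1\<close> the coefficient is then a single product, and its factor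
  \<open>tdeg y - tdeg x\<close> is nonzero by the degree hypothesis.\<close>

lemma tdeg_wbracket:
  assumes "x \<noteq> 0" "tdeg x < tdeg y"
  shows "tdeg (wbracket x y) = tdeg x + tdeg y + 1"
proof (rule antisym)
  show "tdeg (wbracket x y) \<le> tdeg x + tdeg y + 1"
    unfolding tdeg_le_iff
  proof
    fix r assume "r \<in> Poly_Mapping.keys (wbracket x y)"
    then obtain p q where "p \<in> Poly_Mapping.keys x" "q \<in> Poly_Mapping.keys y"
      "r \<in> Poly_Mapping.keys (wbracket (Lgen (fst p) (snd p)) (Lgen (fst q) (snd q)))"
      by (rule keys_wbracketE)
    then show "r \<in> UNIV \<times> {..tdeg x + tdeg y + 1}"
      using keys_wbracket_LgenD(2)[of r "fst p" "snd p" "fst q" "snd q"]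
        snd_le_tdeg[of p x] snd_le_tdeg[of q y] by (cases r) auto
  qed
next
  let ?A = "{\<alpha>. (\<alpha>, tdeg x) \<in> Poly_Mapping.keys x}"
  let ?B = "{\<beta>. (\<beta>, tdeg y) \<in> Poly_Mapping.keys y}"
  have "tdeg y \<noteq> 0" using assms by simp
  then have "y \<noteq> 0" by (auto simp: tdeg_def)
  have "?A \<subseteq> fst ` Poly_Mapping.keys x" "?B \<subseteq> fst ` Poly_Mapping.keys y" by force+
  then have "finite ?A" "finite ?B" by (auto intro: finite_subset)
  moreover have "?A \<noteq> {}" using tdeg_attained[OF \<open>x \<noteq> 0\<close>] by auto
  moreover have "?B \<noteq> {}" using tdeg_attained[OF \<open>y \<noteq> 0\<close>] by auto
  ultimately obtain a b where ab: "a \<in> ?A" "b \<in> ?B"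
    "\<And>a' b'. a' \<in> ?A \<Longrightarrow> b' \<in> ?B \<Longrightarrow> a' + b' = a + b \<Longrightarrow> a' = a \<and> b' = b"
    using unique_sum_complex[of ?A ?B] by blast
  let ?r = "(a + b, tdeg x + tdeg y + 1)"
  have "Poly_Mapping.lookup (wbracket x y) ?r =
    Poly_Mapping.lookup x (a, tdeg x) * Poly_Mapping.lookup y (b, tdeg y) *
    Poly_Mapping.lookup (wbracket (Lgen a (tdeg x)) (Lgen b (tdeg y))) ?r"
  proof (rule lookup_wbracket_single)
    fix p q assume pq: "p \<in> Poly_Mapping.keys x" "q \<in> Poly_Mapping.keys y"
      "(p, q) \<noteq> ((a, tdeg x), (b, tdeg y))"
    show "Poly_Mapping.lookup (wbracket (Lgen (fst p) (snd p)) (Lgen (fst q) (snd q))) ?r = 0"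
    proof (rule ccontr)
      assume "Poly_Mapping.lookup (wbracket (Lgen (fst p) (snd p)) (Lgen (fst q) (snd q))) ?r \<noteq> 0"
      then have "?r \<in> Poly_Mapping.keys (wbracket (Lgen (fst p) (snd p)) (Lgen (fst q) (snd q)))"
        by (simp add: in_keys_iff)
      note r = keys_wbracket_LgenD[OF this]
      \<comment> \<open>A bracket of basis vectors adds at most 1 to the sum of the second indices,
        so both must be maximal to reach \<open>?r\<close>.\<close>
      have "snd p = tdeg x" "snd q = tdeg y"
        using r(2) snd_le_tdeg[OF pq(1)] snd_le_tdeg[OF pq(2)] by auto
      then show False using ab(3)[of "fst p" "fst q"] r(1) pq by (cases p; cases q) auto
    qed
  qed (use ab in auto)
  also have "\<dots> \<noteq> 0"
    using ab assms(2) by (simp add: wbracket_Lgen lookup_add lookup_Lgen in_keys_iff)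
  finally have "?r \<in> Poly_Mapping.keys (wbracket x y)" by (simp add: in_keys_iff)
  then show "tdeg x + tdeg y + 1 \<le> tdeg (wbracket x y)"
    using snd_le_tdeg by fastforce
qed

section \<open>The algebra of a nontrivial group\<close>

locale nontrivial_group =
  fixes \<Gamma> :: "complex set"
  assumes zero_mem: "0 \<in> \<Gamma>"
    and add_mem: "\<alpha> \<in> \<Gamma> \<Longrightarrow> \<beta> \<in> \<Gamma> \<Longrightarrow> \<alpha> + \<beta> \<in> \<Gamma>"
    and minus_mem: "\<alpha> \<in> \<Gamma> \<Longrightarrow> - \<alpha> \<in> \<Gamma>"
    and nontrivial: "\<Gamma> \<noteq> {0}"
begin

sublocale lie: lie_algebra wscale "Walg \<Gamma>" wbracket
  using lie_algebra_Walg add_mem by blast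

lemma diff_mem: "\<alpha> \<in> \<Gamma> \<Longrightarrow> \<beta> \<in> \<Gamma> \<Longrightarrow> \<alpha> - \<beta> \<in> \<Gamma>"
  using add_mem[of \<alpha> "- \<beta>"] minus_mem by simp

lemma nonzero_memE: obtains h where "h \<in> \<Gamma>" "h \<noteq> 0"
  using nontrivial zero_mem by blast

lemma Lgen_in_Walg: "\<alpha> \<in> \<Gamma> \<Longrightarrow> Lgen \<alpha> i \<in> Walg \<Gamma>"
  by (simp add: Walg_conv_Wpow Lgen_in_Wpow)

section \<open>Local finiteness and gradings\<close>

lemma finite_dim_tdeg_bounded:
  assumes "lie.finite_dim S"
  obtains N where "\<And>x. x \<in> S \<Longrightarrow> tdeg x \<le> N"
  using assms span_tdeg_bounded unfolding lie.finite_dim_def by metis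

lemma not_ad_locally_finite:
  assumes "x \<noteq> 0"
  shows "\<not> lie.ad_locally_finite x"
proof
  assume "lie.ad_locally_finite x"
  \<comment> \<open>The start must exceed the degree of x for \<open>tdeg_wbracket\<close> to apply;
    every later iterate is higher still.\<close>
  define y where "y = Lgen 0 (Suc (tdeg x))"
  let ?S = "wvs.span {(wbracket x ^^ i) y | i. True}"
  have "y \<in> Walg \<Gamma>" by (simp add: y_def Lgen_in_Walg zero_mem)
  then have "lie.finite_dim ?S"
    using \<open>lie.ad_locally_finite x\<close> unfolding lie.ad_locally_finite_def by blast
  then obtain N where N: "\<And>z. z \<in> ?S \<Longrightarrow> tdeg z \<le> N"
    by (rule finite_dim_tdeg_bounded) blast
  have "tdeg x + i < tdeg ((wbracket x ^^ i) y)" for i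
  proof (induction i)
    case (Suc i)
    then have "tdeg x < tdeg ((wbracket x ^^ i) y)" by simp
    from tdeg_wbracket[OF assms this] Suc show ?case by simp
  qed (simp add: y_def)
  then have "N < tdeg ((wbracket x ^^ N) y)"
    by (meson add_lessD1 add.commute le_add2 order_le_less_trans)
  moreover have "(wbracket x ^^ N) y \<in> ?S" by (rule wvs.span_base) blast
  ultimately show False using N by fastforce
qed

text \<open>Let \<open>S\<close> be the set of degrees of nonzero components. Composing the adjoint maps of
  homogeneous elements of degrees \<open>a, b, \<dots>\<close> gives a map that raises \<^const>\<open>tdeg\<close> and
  shifts the grading by \<open>ab\<cdots>\<close>; were this product trivial, a homogeneous component would be
  infinite-dimensional. So the semigroup generated by \<open>S\<close> omits the identity and defines
  a strict partial order. But \<open>[Lgen 0 0, Lgen h 0] = h Lgen h 0\<close> forces each degree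
  in the finite support of \<open>Lgen h 0\<close> to lie above another one.\<close>

lemma not_finitely_graded: "\<not> lie.finitely_graded TYPE('g)"
proof
  assume "lie.finitely_graded TYPE('g)"
  then obtain G :: "'g monoid" and U where G: "comm_group G"
    and sum: "lie.is_direct_sum (carrier G) U"
    and br: "\<And>a b. a \<in> carrier G \<Longrightarrow> b \<in> carrier G \<Longrightarrow>
      lie.bracket_space (U a) (U b) \<subseteq> U (a \<otimes>\<^bsub>G\<^esub> b)"
    and fd: "\<And>a. a \<in> carrier G \<Longrightarrow> lie.finite_dim (U a)"
    unfolding lie.finitely_graded_def by blast
  interpret G: comm_group G by (rule G)
  define dec where "dec x f \<longleftrightarrow> (\<forall>a\<in>carrier G. f a \<in> U a) \<and> (\<forall>a. a \<notin> carrier G \<longrightarrow> f a = 0) \<and>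
        finite {a. f a \<noteq> 0} \<and> x = (\<Sum>a | f a \<noteq> 0. f a)" for x f
  have subU: "wvs.subspace (U a)" if "a \<in> carrier G" for a
    using sum that unfolding lie.is_direct_sum_def by blast
  have dec_ex: "\<exists>!f. dec x f" if "x \<in> Walg \<Gamma>" for x
    using sum that unfolding lie.is_direct_sum_def dec_def by blast
  have brU: "wbracket x y \<in> U (a \<otimes>\<^bsub>G\<^esub> b)"
    if "a \<in> carrier G" "b \<in> carrier G" "x \<in> U a" "y \<in> U b" for a b x y
  proof -
    have "wbracket x y \<in> lie.bracket_space (U a) (U b)"
      unfolding lie.bracket_space_def by (rule wvs.span_base) (use that in blast)
    then show ?thesis using br that by blast
  qed
  \<comment> \<open>The two properties survive composition. The threshold N is there because
    \<open>tdeg_wbracket\<close> controls only arguments of larger degree than x.\<close>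
  define raises where "raises a N T \<longleftrightarrow> (\<forall>b\<in>carrier G. \<forall>y\<in>U b. T y \<in> U (a \<otimes>\<^bsub>G\<^esub> b)) \<and>
    (\<forall>y. N \<le> tdeg y \<longrightarrow> tdeg y < tdeg (T y))" for a and N :: nat and T :: "wspace \<Rightarrow> wspace"
  define P where "P = {a \<in> carrier G. \<exists>N T. raises a N T}"
  have P_carrier: "a \<in> carrier G" if "a \<in> P" for a
    using that by (simp add: P_def)
  have P_component: "a \<in> P" if "a \<in> carrier G" "x \<in> U a" "x \<noteq> 0" for a x
  proof -
    have "raises a (Suc (tdeg x)) (wbracket x)"
      unfolding raises_def using brU that tdeg_wbracket[OF that(3)] by auto
    then show ?thesis unfolding P_def using that by blast
  qed
  have P_mult: "a \<otimes>\<^bsub>G\<^esub> b \<in> P" if P: "a \<in> P" "b \<in> P" for a b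
  proof -
    obtain N T N' T' where *: "raises a N T" "raises b N' T'"
      using P unfolding P_def by blast
    have ab: "a \<in> carrier G" "b \<in> carrier G" using P P_carrier by auto
    have "raises (a \<otimes>\<^bsub>G\<^esub> b) (max N N') (T \<circ> T')"
      unfolding raises_def
    proof (intro conjI ballI allI impI)
      fix c y assume "c \<in> carrier G" "y \<in> U c"
      then have "T (T' y) \<in> U (a \<otimes>\<^bsub>G\<^esub> (b \<otimes>\<^bsub>G\<^esub> c))"
        using * ab unfolding raises_def by blast
      then show "(T \<circ> T') y \<in> U (a \<otimes>\<^bsub>G\<^esub> b \<otimes>\<^bsub>G\<^esub> c)"
        using ab \<open>c \<in> carrier G\<close> by (simp add: G.m_assoc)
    next
      fix y assume "max N N' \<le> tdeg y"
      then have "tdeg y < tdeg (T' y)" "N \<le> tdeg y" using * unfolding raises_def by auto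
      moreover from this have "tdeg (T' y) < tdeg (T (T' y))"
        using * unfolding raises_def by (meson less_imp_le order_trans)
      ultimately show "tdeg y < tdeg ((T \<circ> T') y)" by simp
    qed
    then show ?thesis unfolding P_def using ab by blast
  qed
  have P_one: "\<one>\<^bsub>G\<^esub> \<notin> P"
  proof
    assume "\<one>\<^bsub>G\<^esub> \<in> P"
    then obtain N T where T: "raises \<one>\<^bsub>G\<^esub> N T" unfolding P_def by blast
    \<comment> \<open>The coefficient at \<open>(0, N)\<close> is 1, so some homogeneous component
      has a nonzero one there and thus degree at least N, where \<open>T\<close> starts to raise
      degrees.\<close>
    have "Lgen 0 N \<in> Walg \<Gamma>" by (simp add: Lgen_in_Walg zero_mem)
    then obtain f where f: "dec (Lgen 0 N) f" using dec_ex by blast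
    then have "Lgen 0 N = (\<Sum>a | f a \<noteq> 0. f a)" unfolding dec_def by blast
    from arg_cong[OF this, of "\<lambda>x. Poly_Mapping.lookup x (0, N)"]
    have "(\<Sum>a | f a \<noteq> 0. Poly_Mapping.lookup (f a) (0, N)) \<noteq> 0"
      by (simp add: lookup_sum lookup_Lgen)
    then obtain b where b: "f b \<noteq> 0" "Poly_Mapping.lookup (f b) (0, N) \<noteq> 0"
      by (elim sum.not_neutral_contains_not_neutral) auto
    then have bG: "b \<in> carrier G" and fb: "f b \<in> U b" using f unfolding dec_def by blast+
    have "N \<le> tdeg (f b)" using b(2) snd_le_tdeg[of "(0, N)" "f b"] by (simp add: in_keys_iff)
    obtain M where M: "\<And>y. y \<in> U b \<Longrightarrow> tdeg y \<le> M"
      using fd[OF bG] finite_dim_tdeg_bounded by blast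
    \<comment> \<open>A map that shifts by the identity stays inside \<open>U b\<close>, yet the
      degrees grow without bound.\<close>
    have "(T ^^ k) (f b) \<in> U b \<and> N + k \<le> tdeg ((T ^^ k) (f b))" for k
    proof (induction k)
      case (Suc k)
      then have "T ((T ^^ k) (f b)) \<in> U (\<one>\<^bsub>G\<^esub> \<otimes>\<^bsub>G\<^esub> b)"
        and "tdeg ((T ^^ k) (f b)) < tdeg (T ((T ^^ k) (f b)))"
        using T bG unfolding raises_def by auto
      then show ?case using Suc bG by simp
    qed (use fb \<open>N \<le> tdeg (f b)\<close> in simp)
    from this[of "Suc M"] M show False by fastforce
  qed
  obtain h where h: "h \<in> \<Gamma>" "h \<noteq> 0" by (rule nonzero_memE)
  have gens: "Lgen 0 0 \<in> Walg \<Gamma>" "Lgen h 0 \<in> Walg \<Gamma>"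
    by (simp_all add: Lgen_in_Walg zero_mem h)
  obtain f where f: "dec (Lgen 0 0) f" using dec_ex gens by blast
  obtain g where g: "dec (Lgen h 0) g" using dec_ex gens by blast
  define F where "F = {a. f a \<noteq> 0}"
  define H where "H = {a. g a \<noteq> 0}"
  have F: "finite F" "F \<subseteq> carrier G" "Lgen 0 0 = (\<Sum>a\<in>F. f a)"
    and H: "finite H" "H \<subseteq> carrier G" "Lgen h 0 = (\<Sum>a\<in>H. g a)"
    using f g unfolding dec_def F_def H_def by blast+
  have "F \<subseteq> P" using P_component f F(2) unfolding F_def dec_def by blast
  define m where "m = (\<lambda>p. fst p \<otimes>\<^bsub>G\<^esub> snd p :: 'g)"
  define w where "w p = wbracket (f (fst p)) (g (snd p))" for p
  \<comment> \<open>Several pairs of degrees may have the same product c, so the homogeneous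
    component of degree c of the bracket is a sum over all of them.\<close>
  define k where "k c = (\<Sum>p | p \<in> F \<times> H \<and> m p = c. w p)" for c
  have mG: "m p \<in> carrier G" "w p \<in> U (m p)" if "p \<in> F \<times> H" for p
  proof -
    have *: "fst p \<in> carrier G" "snd p \<in> carrier G" using that F(2) H(2) by auto
    then show "m p \<in> carrier G" by (simp add: m_def)
    have "f (fst p) \<in> U (fst p)" "g (snd p) \<in> U (snd p)"
      using f g * unfolding dec_def by auto
    then show "w p \<in> U (m p)" unfolding w_def m_def by (rule brU[OF *])
  qed
  have supp: "{c. k c \<noteq> 0} \<subseteq> m ` (F \<times> H)"
  proof
    fix c assume "c \<in> {c. k c \<noteq> 0}"
    then obtain p where "p \<in> {p. p \<in> F \<times> H \<and> m p = c}"
      unfolding k_def by (auto elim: sum.not_neutral_contains_not_neutral)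
    then show "c \<in> m ` (F \<times> H)" by blast
  qed
  have fin: "finite (m ` (F \<times> H))" using F(1) H(1) by blast
  have "(\<Sum>c | k c \<noteq> 0. k c) = (\<Sum>c\<in>m ` (F \<times> H). k c)"
    using supp fin by (intro sum.mono_neutral_left) auto
  also have "\<dots> = (\<Sum>p\<in>F \<times> H. w p)"
    unfolding k_def using F(1) H(1) by (intro sum.group) auto
  also have "\<dots> = wbracket (Lgen 0 0) (Lgen h 0)"
    unfolding F(3) wbracket_sum_left unfolding H(3) wbracket_sum_right sum.cartesian_product
    by (simp add: case_prod_beta w_def)
  also have "\<dots> = wscale h (Lgen h 0)" by (simp add: wbracket_Lgen)
  finally have k_sum: "wscale h (Lgen h 0) = (\<Sum>c | k c \<noteq> 0. k c)" ..
  have "dec (wscale h (Lgen h 0)) k"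
    unfolding dec_def
  proof (intro conjI ballI allI impI k_sum)
    show "k a \<in> U a" if "a \<in> carrier G" for a
      unfolding k_def using mG by (intro wvs.subspace_sum[OF subU[OF that]]) auto
    show "k a = 0" if "a \<notin> carrier G" for a
      using that supp mG(1) by auto
    show "finite {a. k a \<noteq> 0}" using supp fin by (rule finite_subset)
  qed
  moreover have "dec (wscale h (Lgen h 0)) (\<lambda>a. wscale h (g a))"
  proof -
    have "{a. wscale h (g a) \<noteq> 0} = H" using h by (simp add: H_def)
    moreover have "wscale h (g a) \<in> U a" if "a \<in> carrier G" for a
      using g that wvs.subspace_scale[OF subU[OF that]] unfolding dec_def by blast
    moreover have "wscale h (g a) = 0" if "a \<notin> carrier G" for a
      using g that unfolding dec_def by simp
    ultimately show ?thesis
      unfolding dec_def using H by (simp add: wvs.scale_sum_right)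
  qed
  moreover have "wscale h (Lgen h 0) \<in> Walg \<Gamma>"
    using gens(2) by (simp add: Walg_iff keys_wscale)
  \<comment> \<open>Uniqueness of components, applied to the bracket computed in two ways: every
    degree of \<open>Lgen h 0\<close> is a degree of \<open>Lgen 0 0\<close> times a degree of
    \<open>Lgen h 0\<close>.\<close>
  ultimately have k_eq: "k = (\<lambda>a. wscale h (g a))" using dec_ex by blast
  define R where "R b' b \<longleftrightarrow> (\<exists>a\<in>P. b = a \<otimes>\<^bsub>G\<^esub> b')" for b' b
  have pred: "\<exists>b'\<in>H. R b' b" if "b \<in> H" for b
  proof -
    have "k b \<noteq> 0" using that h by (simp add: k_eq H_def)
    then obtain p where "p \<in> F \<times> H" "m p = b" using supp by auto
    then have "fst p \<in> P" "snd p \<in> H" "b = fst p \<otimes>\<^bsub>G\<^esub> snd p"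
      using \<open>F \<subseteq> P\<close> by (auto simp: m_def)
    then show ?thesis unfolding R_def by blast
  qed
  have R_trans: "R x z" if "R x y" "R y z" "x \<in> carrier G" for x y z
  proof -
    obtain a b where "a \<in> P" "y = a \<otimes>\<^bsub>G\<^esub> x" "b \<in> P" "z = b \<otimes>\<^bsub>G\<^esub> y"
      using \<open>R x y\<close> \<open>R y z\<close> unfolding R_def by blast
    then have "z = (b \<otimes>\<^bsub>G\<^esub> a) \<otimes>\<^bsub>G\<^esub> x" using P_carrier that(3) by (simp add: G.m_assoc)
    then show ?thesis unfolding R_def using P_mult \<open>a \<in> P\<close> \<open>b \<in> P\<close> by blast
  qed
  have R_irrefl: "\<not> R x x" if "x \<in> carrier G" for x
  proof
    assume "R x x"
    then obtain a where "a \<in> P" "x = a \<otimes>\<^bsub>G\<^esub> x" unfolding R_def by blast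
    then have "a = \<one>\<^bsub>G\<^esub>" using that P_carrier by (metis G.r_cancel_one')
    then show False using \<open>a \<in> P\<close> P_one by simp
  qed
  have "H \<noteq> {}"
  proof
    assume "H = {}"
    then have "Lgen h 0 = 0" using H(3) by simp
    then show False using keys_Lgen[of h 0] by simp
  qed
  have "\<exists>b\<in>H. \<forall>b'\<in>H. b' \<noteq> b \<longrightarrow> \<not> R b' b"
  proof (rule Finite_Set.bex_min_element[OF H(1) _ _ \<open>H \<noteq> {}\<close>])
    show "asymp_on H R"
      using R_trans R_irrefl H(2) unfolding asymp_on_def by blast
    show "transp_on H R"
      using R_trans H(2) unfolding transp_on_def by blast
  qed
  \<comment> \<open>The minimal element has a predecessor by \<open>pred\<close>, and irreflexivity
    makes it a different element.\<close>
  then show False using pred R_irrefl H(2) by (metis subsetD)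
qed

section \<open>Ideals\<close>

lemma Wpow_mono: "m \<le> n \<Longrightarrow> Wpow \<Gamma> n \<subseteq> Wpow \<Gamma> m"
  by (force simp: Wpow_iff subset_iff)

lemma Wpow_inj: "Wpow \<Gamma> m = Wpow \<Gamma> n \<Longrightarrow> m = n"
proof -
  have "n \<le> m" if "Wpow \<Gamma> m \<subseteq> Wpow \<Gamma> n" for m n
  proof -
    have "Lgen 0 m \<in> Wpow \<Gamma> m" by (simp add: Lgen_in_Wpow zero_mem)
    then have "Lgen 0 m \<in> Wpow \<Gamma> n" using that by blast
    then show ?thesis by (simp add: Wpow_iff)
  qed
  then show "m = n" if "Wpow \<Gamma> m = Wpow \<Gamma> n" using that by (metis antisym order_refl)
qed

lemma wbracket_in_Wpow:
  assumes "x \<in> Wpow \<Gamma> m" "y \<in> Wpow \<Gamma> n"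
  shows "wbracket x y \<in> Wpow \<Gamma> (m + n)"
  unfolding Wpow_iff
proof
  fix r assume "r \<in> Poly_Mapping.keys (wbracket x y)"
  then obtain p q where pq: "p \<in> Poly_Mapping.keys x" "q \<in> Poly_Mapping.keys y"
    "r \<in> Poly_Mapping.keys (wbracket (Lgen (fst p) (snd p)) (Lgen (fst q) (snd q)))"
    by (rule keys_wbracketE)
  have "fst p \<in> \<Gamma>" "m \<le> snd p" "fst q \<in> \<Gamma>" "n \<le> snd q"
    using assms pq(1,2) unfolding Wpow_iff by auto
  then have "fst r \<in> \<Gamma>" "m + n \<le> snd r"
    using keys_wbracket_LgenD[OF pq(3)] add_mem by auto
  then show "r \<in> \<Gamma> \<times> {m + n..}" by (cases r) auto
qed

lemma lie_ideal_Wpow: "lie.lie_ideal (Wpow \<Gamma> n)"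
  unfolding lie.lie_ideal_def
proof (intro conjI ballI)
  show "wvs.subspace (Wpow \<Gamma> n)" by (simp add: Wpow_def)
  show "Wpow \<Gamma> n \<subseteq> Walg \<Gamma>" by (simp add: Walg_conv_Wpow Wpow_mono)
  show "wbracket x y \<in> Wpow \<Gamma> n" if "x \<in> Walg \<Gamma>" "y \<in> Wpow \<Gamma> n" for x y
    using wbracket_in_Wpow[of x 0 y n] that by (simp add: Walg_conv_Wpow)
qed

lemma Wpow_nonzero: "Wpow \<Gamma> n \<noteq> {0}"
proof
  assume "Wpow \<Gamma> n = {0}"
  moreover have "Lgen 0 n \<in> Wpow \<Gamma> n" by (simp add: Lgen_in_Wpow zero_mem)
  ultimately show False using keys_Lgen[of 0 n] by simp
qed

context
  fixes I
  assumes ideal: "lie.lie_ideal I"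
begin

lemma subspace_I: "wvs.subspace I"
  and I_subset: "I \<subseteq> Walg \<Gamma>"
  and wbracket_in_I: "x \<in> Walg \<Gamma> \<Longrightarrow> y \<in> I \<Longrightarrow> wbracket x y \<in> I"
  using ideal unfolding lie.lie_ideal_def by auto

lemma unscale_in_I:
  assumes "wscale c x \<in> I" "c \<noteq> 0"
  shows "x \<in> I"
  using wvs.subspace_scale[OF subspace_I assms(1), of "inverse c"] assms(2) by simp

lemma Lgen_mult_in_I:
  assumes "\<delta> \<in> \<Gamma>" "f \<in> I"
  shows "Lgen \<delta> k * f \<in> I"
proof -
  \<comment> \<open>Nontriviality of \<Gamma> enters here: the factor -4 h^2 has to be
    invertible.\<close>
  obtain h where h: "h \<in> \<Gamma>" "h \<noteq> 0" by (rule nonzero_memE)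
  have "wbracket (Lgen \<alpha> i) (wbracket (Lgen \<beta> j) f) \<in> I" if "\<alpha> \<in> \<Gamma>" "\<beta> \<in> \<Gamma>" for \<alpha> \<beta> i j
    using that assms(2) by (intro wbracket_in_I Lgen_in_Walg)
  then have "wbracket (Lgen (\<delta> - h) k) (wbracket (Lgen h 0) f)
   + wbracket (Lgen (\<delta> + h) k) (wbracket (Lgen (- h) 0) f)
   - wscale 2 (wbracket (Lgen \<delta> k) (wbracket (Lgen 0 0) f)) \<in> I"
    using assms(1) h(1)
    by (intro wvs.subspace_diff wvs.subspace_add wvs.subspace_scale subspace_I)
      (simp_all add: add_mem diff_mem minus_mem zero_mem)
  then have "wscale (- 4 * h\<^sup>2) (Lgen \<delta> k * f) \<in> I"
    unfolding wbracket_second_difference .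
  then show ?thesis by (rule unscale_in_I) (use h in simp)
qed

text \<open>Multiplication by \<open>Lgen (\<beta> - \<alpha>) (i - n)\<close> reaches every
  generator of W^n.\<close>

lemma Wpow_subset_I:
  assumes "\<alpha> \<in> \<Gamma>" "Lgen \<alpha> n \<in> I"
  shows "Wpow \<Gamma> n \<subseteq> I"
proof -
  have "Lgen \<beta> i \<in> I" if "\<beta> \<in> \<Gamma>" "n \<le> i" for \<beta> i
    using Lgen_mult_in_I[of "\<beta> - \<alpha>" "Lgen \<alpha> n" "i - n"] that assms
    by (simp add: Lgen_mult diff_mem)
  then show ?thesis
    unfolding Wpow_def by (intro wvs.span_minimal subspace_I) auto
qed

lemma Lgen_in_I_of_keys:
  assumes "f \<in> I" "Poly_Mapping.keys f = {(\<alpha>, i)}"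
  shows "Lgen \<alpha> i \<in> I"
proof -
  have "wscale (Poly_Mapping.lookup f (\<alpha>, i)) (Lgen \<alpha> i) \<in> I"
    using wspace_expand[of f] assms by simp
  moreover have "Poly_Mapping.lookup f (\<alpha>, i) \<noteq> 0"
    using assms(2) by (simp flip: in_keys_iff)
  ultimately show ?thesis by (rule unscale_in_I)
qed

text \<open>If \<open>p\<close> is the part of \<open>f\<close> with first index \<open>0\<close>, then \<open>[p, f] = [p, f - p]\<close> has
  one first index fewer than \<open>f\<close>.\<close>

lemma exists_column_0:
  assumes "f \<in> I" "f \<noteq> 0"
  shows "\<exists>g\<in>I. fst ` Poly_Mapping.keys g = {0}"
  using assms
proof (induction "card (fst ` Poly_Mapping.keys f)" arbitrary: f rule: less_induct)
  case less
  from \<open>f \<noteq> 0\<close> obtain \<alpha> i0 where \<alpha>: "(\<alpha>, i0) \<in> Poly_Mapping.keys f"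
    by (rule nonzero_keyE)
  then have "\<alpha> \<in> \<Gamma>" using less.prems(1) I_subset Walg_iff[of f \<Gamma>] by force
  \<comment> \<open>A shift that carries the column \<alpha> to 0 and preserves the number of
    columns.\<close>
  define f' where "f' = Lgen (- \<alpha>) 0 * f"
  have f'I: "f' \<in> I" unfolding f'_def using \<open>\<alpha> \<in> \<Gamma>\<close> less.prems(1)
    by (intro Lgen_mult_in_I minus_mem)
  have fst_f': "fst ` Poly_Mapping.keys f' = (+) (- \<alpha>) ` fst ` Poly_Mapping.keys f"
    by (simp add: f'_def keys_Lgen_mult image_image)
  have card: "card (fst ` Poly_Mapping.keys f') = card (fst ` Poly_Mapping.keys f)"
    unfolding fst_f' by (intro card_image) simp
  have "\<alpha> \<in> fst ` Poly_Mapping.keys f" using imageI[OF \<alpha>, of fst] by simp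
  then have zero: "0 \<in> fst ` Poly_Mapping.keys f'"
    unfolding fst_f' by (intro image_eqI[of _ _ \<alpha>]) simp_all
  define p where "p = wrestrict ({0} \<times> UNIV) f'"
  define r where "r = wrestrict (- ({0} \<times> UNIV)) f'"
  have f': "f' = p + r" unfolding p_def r_def wrestrict_compl[symmetric] by simp
  have keys_p: "Poly_Mapping.keys p = Poly_Mapping.keys f' \<inter> {0} \<times> UNIV"
    and keys_r: "Poly_Mapping.keys r = Poly_Mapping.keys f' - {0} \<times> UNIV"
    by (auto simp: p_def r_def keys_wrestrict)
  show ?case
  proof (cases "r = 0")
    case True
    then have "Poly_Mapping.keys f' \<subseteq> {0} \<times> UNIV" using keys_r by auto
    then have "fst ` Poly_Mapping.keys f' = {0}" using zero by auto
    then show ?thesis using f'I by blast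
  next
    case False
    have "fst ` Poly_Mapping.keys p \<subseteq> \<Gamma>" using keys_p zero_mem by auto
    then have "p \<in> Walg \<Gamma>" by (simp add: Walg_iff)
    then have "wbracket p r \<in> I"
      using wbracket_in_I[OF _ f'I, of p] by (simp add: f' wbracket_add_right wbracket_self)
    have fst_keys: "fst ` Poly_Mapping.keys (wbracket p r) \<subseteq> fst ` Poly_Mapping.keys r"
    proof
      fix \<gamma> assume "\<gamma> \<in> fst ` Poly_Mapping.keys (wbracket p r)"
      then obtain s where "\<gamma> = fst s" and s_in: "s \<in> Poly_Mapping.keys (wbracket p r)"
        by (rule imageE)
      from s_in obtain u q where u: "u \<in> Poly_Mapping.keys p" and q: "q \<in> Poly_Mapping.keys r"
        and s: "s \<in> Poly_Mapping.keys (wbracket (Lgen (fst u) (snd u)) (Lgen (fst q) (snd q)))"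
        by (rule keys_wbracketE)
      have "fst u = 0" using u unfolding keys_p by auto
      then have "\<gamma> = fst q" using keys_wbracket_LgenD(1)[OF s] \<open>\<gamma> = fst s\<close> by simp
      then show "\<gamma> \<in> fst ` Poly_Mapping.keys r" using q by simp
    qed
    have "fst ` Poly_Mapping.keys r \<subset> fst ` Poly_Mapping.keys f'"
      using zero keys_r by auto
    then have "fst ` Poly_Mapping.keys (wbracket p r) \<subset> fst ` Poly_Mapping.keys f'"
      using fst_keys by blast
    then have less_card: "card (fst ` Poly_Mapping.keys (wbracket p r)) < card (fst ` Poly_Mapping.keys f)"
      unfolding card[symmetric] by (intro psubset_card_mono) auto
    have "wbracket p r \<noteq> 0"
    proof -
      from False obtain \<beta> j0 where \<beta>: "(\<beta>, j0) \<in> Poly_Mapping.keys r"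
        by (rule nonzero_keyE)
      then have "\<beta> \<noteq> 0" using keys_r by auto
      \<comment> \<open>Lowest indices are used because the factor at \<open>i + j\<close> is
        \<beta> - 0, which is nonzero; at the top the factor j - i could vanish.\<close>
      define j where "j = (LEAST j. (\<beta>, j) \<in> Poly_Mapping.keys r)"
      have j: "(\<beta>, j) \<in> Poly_Mapping.keys r"
        unfolding j_def by (rule LeastI, rule \<beta>)
      have j_le: "j \<le> j'" if "(\<beta>, j') \<in> Poly_Mapping.keys r" for j'
        unfolding j_def by (rule Least_le, rule that)
      from zero obtain i1 where i1: "(0, i1) \<in> Poly_Mapping.keys p" using keys_p by auto
      define i where "i = (LEAST i. (0, i) \<in> Poly_Mapping.keys p)"
      have i: "(0, i) \<in> Poly_Mapping.keys p"
        unfolding i_def by (rule LeastI, rule i1)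
      have i_le: "i \<le> i'" if "(0, i') \<in> Poly_Mapping.keys p" for i'
        unfolding i_def by (rule Least_le, rule that)
      have "Poly_Mapping.lookup (wbracket p r) (\<beta>, i + j) =
        Poly_Mapping.lookup p (0, i) * Poly_Mapping.lookup r (\<beta>, j) *
        Poly_Mapping.lookup (wbracket (Lgen 0 i) (Lgen \<beta> j)) (\<beta>, i + j)"
      proof (rule lookup_wbracket_single[OF i j])
        fix s q assume s: "s \<in> Poly_Mapping.keys p" and q: "q \<in> Poly_Mapping.keys r"
          and ne: "(s, q) \<noteq> ((0, i), (\<beta>, j))"
        show "Poly_Mapping.lookup (wbracket (Lgen (fst s) (snd s)) (Lgen (fst q) (snd q))) (\<beta>, i + j) = 0"
        proof (rule ccontr)
          assume "\<not> ?thesis"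
          then have "(\<beta>, i + j) \<in>
            Poly_Mapping.keys (wbracket (Lgen (fst s) (snd s)) (Lgen (fst q) (snd q)))"
            by (simp add: in_keys_iff)
          note * = keys_wbracket_LgenD[OF this]
          have "fst s = 0" using s unfolding keys_p by auto
          then obtain i' where i': "s = (0, i')" by (cases s) simp
          then have "fst q = \<beta>" using *(1) by simp
          then obtain j' where j': "q = (\<beta>, j')" by (cases q) simp
          have "i \<le> i'" using s unfolding i' by (rule i_le)
          moreover have "j \<le> j'" using q unfolding j' by (rule j_le)
          ultimately show False using *(2) ne by (simp add: i' j')
        qed
      qed
      also have "\<dots> \<noteq> 0"
        using i j \<open>\<beta> \<noteq> 0\<close> by (simp add: wbracket_Lgen lookup_add lookup_Lgen in_keys_iff)
      finally show ?thesis by auto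
    qed
    then show ?thesis using less.hyps[OF less_card \<open>wbracket p r \<in> I\<close>] by blast
  qed
qed

text \<open>In column 0 the bracket of \<open>Lgen 0 d\<close> and \<open>Lgen 0 j\<close> is (j -
  d) times \<open>Lgen 0 (d + j + 1)\<close>. Bracketing with \<open>Lgen 0 d\<close> thus deletes
  the term of index d and only shifts the others, until one term is left.\<close>

lemma exists_Lgen_in_I:
  assumes "f \<in> I" "fst ` Poly_Mapping.keys f = {0}"
  shows "\<exists>M. Lgen 0 M \<in> I"
  using assms
proof (induction "card (Poly_Mapping.keys f)" arbitrary: f rule: less_induct)
  case less
  have fst0: "fst q = 0" if "q \<in> Poly_Mapping.keys f" for q
    using imageI[OF that, of fst] less.prems(2) by simp
  have "f \<noteq> 0" using less.prems(2) by auto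
  then obtain \<alpha> d where "(\<alpha>, d) \<in> Poly_Mapping.keys f" by (rule nonzero_keyE)
  moreover from this have "\<alpha> = 0" using fst0 by fastforce
  ultimately have d: "(0, d) \<in> Poly_Mapping.keys f" by simp
  show ?case
  proof (cases "Poly_Mapping.keys f = {(0, d)}")
    case True
    then show ?thesis using Lgen_in_I_of_keys less.prems(1) by blast
  next
    case False
    then obtain q where "q \<in> Poly_Mapping.keys f" "q \<noteq> (0, d)" using d by blast
    moreover from this have "fst q = 0" using fst0 by simp
    ultimately obtain j where j: "(0, j) \<in> Poly_Mapping.keys f" "j \<noteq> d" by (cases q) auto
    define g where "g = wbracket (Lgen 0 d) f"
    have gI: "g \<in> I" unfolding g_def using less.prems(1)
      by (intro wbracket_in_I Lgen_in_Walg zero_mem)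
    have keys_g: "Poly_Mapping.keys g \<subseteq>
      (\<lambda>p. (0, snd p + d + 1)) ` (Poly_Mapping.keys f - {(0, d)})"
    proof
      fix r assume "r \<in> Poly_Mapping.keys g"
      then obtain p q where p: "p \<in> Poly_Mapping.keys (Lgen 0 d)" and q: "q \<in> Poly_Mapping.keys f"
        "r \<in> Poly_Mapping.keys (wbracket (Lgen (fst p) (snd p)) (Lgen (fst q) (snd q)))"
        unfolding g_def by (rule keys_wbracketE)
      have "p = (0, d)" using p by simp
      have "fst q = 0" using q(1) by (rule fst0)
      then have "snd q \<noteq> d" "r = (0, snd q + d + 1)"
        using q(2) \<open>p = (0, d)\<close> by (auto simp: wbracket_Lgen keys_wscale split: if_splits)
      then show "r \<in> (\<lambda>p. (0, snd p + d + 1)) ` (Poly_Mapping.keys f - {(0, d)})"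
        using q(1) by (intro image_eqI[of _ _ q]) auto
    qed
    have "card (Poly_Mapping.keys g) \<le> card (Poly_Mapping.keys f - {(0, d)})"
      by (rule surj_card_le[OF _ keys_g]) simp
    also have "\<dots> < card (Poly_Mapping.keys f)"
      using d by (intro psubset_card_mono) auto
    finally have less_card: "card (Poly_Mapping.keys g) < card (Poly_Mapping.keys f)" .
    have "Poly_Mapping.lookup g (0, d + j + 1) =
      Poly_Mapping.lookup (Lgen 0 d) (0, d) * Poly_Mapping.lookup f (0, j) *
      Poly_Mapping.lookup (wbracket (Lgen 0 d) (Lgen 0 j)) (0, d + j + 1)"
      unfolding g_def
    proof (rule lookup_wbracket_single[OF _ j(1)])
      fix s q assume s: "s \<in> Poly_Mapping.keys (Lgen 0 d)" and q: "q \<in> Poly_Mapping.keys f"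
        and ne: "(s, q) \<noteq> ((0, d), (0, j))"
      have "s = (0, d)" "fst q = 0" using s fst0[OF q] by simp_all
      moreover from this ne have "snd q \<noteq> j" by (cases q) auto
      ultimately show "Poly_Mapping.lookup (wbracket (Lgen (fst s) (snd s)) (Lgen (fst q) (snd q))) (0, d + j + 1) = 0"
        by (simp add: wbracket_Lgen lookup_Lgen)
    qed simp
    also have "\<dots> \<noteq> 0"
      using j by (simp add: wbracket_Lgen lookup_Lgen in_keys_iff)
    finally have "(0, d + j + 1) \<in> Poly_Mapping.keys g" by (simp add: in_keys_iff)
    then have "0 \<in> fst ` Poly_Mapping.keys g" using imageI[of _ _ fst] by fastforce
    moreover have "fst ` Poly_Mapping.keys g \<subseteq> {0}" using image_mono[OF keys_g, of fst] by auto
    ultimately have "fst ` Poly_Mapping.keys g = {0}" by blast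
    then show ?thesis by (rule less.hyps[OF less_card gI])
  qed
qed

text \<open>Modulo W^(m+1), which lies in \<open>I\<close>, D acts diagonally on layer m, with
  eigenvalue \<gamma> on \<open>Lgen \<gamma> m\<close>. Hence D - \<alpha> deletes the term at
  \<alpha> and keeps those at all other first indices.\<close>

lemma Lgen_in_I_of_layer:
  assumes "Wpow \<Gamma> (Suc m) \<subseteq> I" "f \<in> I" "f \<noteq> 0" "snd ` Poly_Mapping.keys f \<subseteq> {m}"
  shows "\<exists>\<alpha>\<in>\<Gamma>. Lgen \<alpha> m \<in> I"
  using assms(2-)
proof (induction "card (Poly_Mapping.keys f)" arbitrary: f rule: less_induct)
  case less
  from \<open>f \<noteq> 0\<close> obtain \<alpha> i where "(\<alpha>, i) \<in> Poly_Mapping.keys f"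
    by (rule nonzero_keyE)
  moreover from this have "i = m" using less.prems(3) by auto
  ultimately have \<alpha>: "(\<alpha>, m) \<in> Poly_Mapping.keys f" by simp
  have "f \<in> Walg \<Gamma>" using less.prems(1) I_subset by (rule subsetD[rotated])
  then have "\<alpha> \<in> \<Gamma>" using imageI[OF \<alpha>, of fst] unfolding Walg_iff by auto
  show ?case
  proof (cases "Poly_Mapping.keys f = {(\<alpha>, m)}")
    case True
    then show ?thesis using Lgen_in_I_of_keys[OF less.prems(1)] \<open>\<alpha> \<in> \<Gamma>\<close> by blast
  next
    case False
    then obtain q where "q \<in> Poly_Mapping.keys f" "q \<noteq> (\<alpha>, m)" using \<alpha> by blast
    moreover from this have "snd q = m" using less.prems(3) by auto
    ultimately obtain \<beta> where \<beta>: "(\<beta>, m) \<in> Poly_Mapping.keys f" "\<beta> \<noteq> \<alpha>" by (cases q) auto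
    define g where "g = wbracket (Lgen 0 0) f - wscale \<alpha> f"
    have gI: "g \<in> I" unfolding g_def using less.prems(1)
      by (intro wvs.subspace_diff subspace_I wvs.subspace_scale wbracket_in_I Lgen_in_Walg zero_mem)
    have lookup_f: "Poly_Mapping.lookup f (\<gamma>, i) = 0" if "i \<noteq> m" for \<gamma> i
    proof (rule ccontr)
      assume "Poly_Mapping.lookup f (\<gamma>, i) \<noteq> 0"
      then have "(\<gamma>, i) \<in> Poly_Mapping.keys f" by (simp add: in_keys_iff)
      from imageI[OF this, of snd] show False using less.prems(3) that by auto
    qed
    have lookup_g: "Poly_Mapping.lookup g (\<gamma>, m) = (\<gamma> - \<alpha>) * Poly_Mapping.lookup f (\<gamma>, m)" for \<gamma>
      using lookup_f[of "m - 1"]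
      by (cases "m = 0") (auto simp: g_def Lgen_0_0 lookup_wbracket_one lookup_minus algebra_simps)
    have low: "Poly_Mapping.lookup g (\<gamma>, i) = 0" if "i < m" for \<gamma> i
      using lookup_f[of i] lookup_f[of "i - 1"] that
      by (auto simp: g_def Lgen_0_0 lookup_wbracket_one lookup_minus)
    \<comment> \<open>D also produces terms in layer m + 1; they are cut off so that the induction
      hypothesis applies.\<close>
    define g' where "g' = wrestrict (UNIV \<times> {m}) g"
    have "g - g' \<in> Wpow \<Gamma> (Suc m)"
      unfolding Wpow_iff g'_def wrestrict_compl keys_wrestrict
    proof
      fix r assume r: "r \<in> Poly_Mapping.keys g \<inter> - (UNIV \<times> {m})"
      have "fst ` Poly_Mapping.keys g \<subseteq> \<Gamma>" using subsetD[OF I_subset gI] by (simp add: Walg_iff)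
      then have "fst r \<in> \<Gamma>" using r imageI[of r "Poly_Mapping.keys g" fst] by auto
      moreover have "\<not> snd r < m" using r low[of "snd r" "fst r"] by (auto simp: in_keys_iff)
      ultimately show "r \<in> \<Gamma> \<times> {Suc m..}" using r by (cases r) auto
    qed
    then have "g - (g - g') \<in> I" using gI assms(1) by (blast intro: wvs.subspace_diff[OF subspace_I])
    then have g'I: "g' \<in> I" by simp
    have keys_g': "Poly_Mapping.keys g' \<subseteq> Poly_Mapping.keys f - {(\<alpha>, m)}"
      by (auto simp: g'_def keys_wrestrict in_keys_iff lookup_g)
    then have "Poly_Mapping.keys g' \<subset> Poly_Mapping.keys f" using \<alpha> by blast
    then have less_card: "card (Poly_Mapping.keys g') < card (Poly_Mapping.keys f)"
      by (intro psubset_card_mono) auto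
    have "(\<beta>, m) \<in> Poly_Mapping.keys g'"
      using \<beta> by (simp add: g'_def keys_wrestrict in_keys_iff lookup_g)
    then have "g' \<noteq> 0" by auto
    moreover have "snd ` Poly_Mapping.keys g' \<subseteq> {m}" by (auto simp: g'_def keys_wrestrict)
    ultimately show ?thesis using less.hyps[OF less_card g'I] by blast
  qed
qed

text \<open>For the least n with \<open>Lgen 0 n\<close> in \<open>I\<close>, W^n lies in
  \<open>I\<close>. An element of \<open>I\<close> with a term below layer n could be raised until
  its lowest layer is n - 1; everything above that layer lies in W^n, so the layer itself is in
  \<open>I\<close> and yields \<open>Lgen 0 (n - 1)\<close>, against minimality.\<close>

lemma ideal_conv_Wpow:
  assumes "I \<noteq> {0}"
  shows "I \<in> range (Wpow \<Gamma>)"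
proof -
  obtain f0 where "f0 \<in> I" "f0 \<noteq> 0"
    using assms wvs.subspace_0[OF subspace_I] by blast
  then have ex: "\<exists>M. Lgen 0 M \<in> I" using exists_column_0 exists_Lgen_in_I by blast
  define n where "n = (LEAST M. Lgen 0 M \<in> I)"
  have "Lgen 0 n \<in> I" unfolding n_def using ex by (rule LeastI_ex)
  then have sub: "Wpow \<Gamma> n \<subseteq> I" by (rule Wpow_subset_I[OF zero_mem])
  have "n \<le> snd q" if f: "f \<in> I" "q \<in> Poly_Mapping.keys f" for f q
  proof (rule ccontr)
    assume "\<not> n \<le> snd q"
    define i where "i = Min (snd ` Poly_Mapping.keys f)"
    have i_le: "i \<le> snd p" if "p \<in> Poly_Mapping.keys f" for p
      using that by (simp add: i_def)
    have "i < n" using i_le[OF f(2)] \<open>\<not> n \<le> snd q\<close> by simp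
    have "i \<in> snd ` Poly_Mapping.keys f" unfolding i_def using f(2) by (intro Min_in) auto
    then obtain p where "i = snd p" "p \<in> Poly_Mapping.keys f" by (rule imageE)
    then have p: "(fst p, i) \<in> Poly_Mapping.keys f" by simp
    \<comment> \<open>Since \<open>i < n\<close>, the subtraction is exact and the lowest layer i
      moves to n - 1.\<close>
    define f' where "f' = Lgen 0 (n - 1 - i) * f"
    have f'I: "f' \<in> I" unfolding f'_def using f(1) by (intro Lgen_mult_in_I zero_mem)
    have keys_f': "n - 1 \<le> snd p" if "p \<in> Poly_Mapping.keys f'" for p
    proof -
      obtain q where "q \<in> Poly_Mapping.keys f" "p = (0 + fst q, n - 1 - i + snd q)"
        using \<open>p \<in> Poly_Mapping.keys f'\<close> unfolding f'_def keys_Lgen_mult by (elim imageE)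
      then show ?thesis using i_le[of q] by simp
    qed
    define g where "g = wrestrict (UNIV \<times> {n - 1}) f'"
    have "f' - g \<in> Wpow \<Gamma> n"
      unfolding Wpow_iff g_def wrestrict_compl keys_wrestrict
    proof
      fix r assume r: "r \<in> Poly_Mapping.keys f' \<inter> - (UNIV \<times> {n - 1})"
      have "fst ` Poly_Mapping.keys f' \<subseteq> \<Gamma>" using subsetD[OF I_subset f'I] by (simp add: Walg_iff)
      then have "fst r \<in> \<Gamma>" using r imageI[of r "Poly_Mapping.keys f'" fst] by auto
      then show "r \<in> \<Gamma> \<times> {n..}" using r keys_f'[of r] by (cases r) auto
    qed
    then have "f' - (f' - g) \<in> I" using f'I sub by (blast intro: wvs.subspace_diff[OF subspace_I])
    then have gI: "g \<in> I" by simp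
    have "(0 + fst (fst p, i), n - 1 - i + snd (fst p, i)) \<in> Poly_Mapping.keys f'"
      unfolding f'_def keys_Lgen_mult by (rule imageI, rule p)
    then have "(fst p, n - 1) \<in> Poly_Mapping.keys g"
      using \<open>i < n\<close> by (simp add: g_def keys_wrestrict)
    then have "g \<noteq> 0" by auto
    moreover have "snd ` Poly_Mapping.keys g \<subseteq> {n - 1}" by (auto simp: g_def keys_wrestrict)
    moreover have "Wpow \<Gamma> (Suc (n - 1)) \<subseteq> I" using sub \<open>i < n\<close> by simp
    ultimately obtain \<beta> where "\<beta> \<in> \<Gamma>" "Lgen \<beta> (n - 1) \<in> I" using Lgen_in_I_of_layer gI by blast
    then have "Lgen 0 (n - 1) \<in> I" using Wpow_subset_I Lgen_in_Wpow zero_mem by blast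
    then have "n \<le> n - 1" unfolding n_def by (rule Least_le)
    then show False using \<open>i < n\<close> by simp
  qed
  note snd_ge = this
  have "f \<in> Wpow \<Gamma> n" if "f \<in> I" for f
    unfolding Wpow_iff
  proof
    fix q assume q: "q \<in> Poly_Mapping.keys f"
    have "fst ` Poly_Mapping.keys f \<subseteq> \<Gamma>"
      using subsetD[OF I_subset \<open>f \<in> I\<close>] by (simp add: Walg_iff)
    then show "q \<in> \<Gamma> \<times> {n..}"
      using imageI[OF q, of fst] snd_ge[OF \<open>f \<in> I\<close> q] by (cases q) auto
  qed
  then have "I \<subseteq> Wpow \<Gamma> n" by blast
  then show ?thesis using sub by blast
qed

end

section \<open>Classification of the ideals and iterated brackets with W^1\<close>

lemma nonzero_ideals: "{I. lie.lie_ideal I \<and> I \<noteq> {0}} = range (Wpow \<Gamma>)"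
proof
  show "{I. lie.lie_ideal I \<and> I \<noteq> {0}} \<subseteq> range (Wpow \<Gamma>)"
    by (intro subsetI ideal_conv_Wpow) simp_all
  show "range (Wpow \<Gamma>) \<subseteq> {I. lie.lie_ideal I \<and> I \<noteq> {0}}"
    by (simp add: image_subset_iff lie_ideal_Wpow Wpow_nonzero)
qed

text \<open>By the classification, a proper nonzero ideal is some W^n with n > 0 and so lies in W^1;
  the zero ideal is treated apart.\<close>

lemma maximal_ideal_iff: "lie.maximal_lie_ideal M \<longleftrightarrow> M = Wpow \<Gamma> 1"
proof
  assume M: "lie.maximal_lie_ideal M"
  have "Wpow \<Gamma> 1 \<noteq> Walg \<Gamma>" using Wpow_inj[of 1 0] by (auto simp: Walg_conv_Wpow)
  moreover have "M \<subseteq> Wpow \<Gamma> 1"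
  proof (cases "M = {0}")
    case True
    then show ?thesis by (simp add: Wpow_def wvs.span_zero)
  next
    case False
    moreover have "lie.lie_ideal M" using M unfolding lie.maximal_lie_ideal_def by (rule conjunct1)
    ultimately obtain n where n: "M = Wpow \<Gamma> n" using ideal_conv_Wpow[of M] by auto
    have "M \<noteq> Walg \<Gamma>" using M unfolding lie.maximal_lie_ideal_def by blast
    then have "n \<noteq> 0" by (auto simp: n Walg_conv_Wpow)
    then show ?thesis unfolding n by (intro Wpow_mono) simp
  qed
  ultimately show "M = Wpow \<Gamma> 1"
    using M lie_ideal_Wpow unfolding lie.maximal_lie_ideal_def by blast
next
  assume M: "M = Wpow \<Gamma> 1"
  have "J = M" if J: "lie.lie_ideal J" "M \<subseteq> J" "J \<noteq> Walg \<Gamma>" for J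
  proof -
    have "J \<noteq> {0}"
    proof
      assume "J = {0}"
      moreover have "0 \<in> M" by (simp add: M Wpow_def wvs.span_zero)
      ultimately have "M = {0}" using J(2) by auto
      then show False using Wpow_nonzero M by simp
    qed
    then obtain n where n: "J = Wpow \<Gamma> n" using ideal_conv_Wpow[OF J(1)] by auto
    have "n \<noteq> 0" using J(3) by (auto simp: n Walg_conv_Wpow)
    then have "J \<subseteq> M" unfolding n M by (intro Wpow_mono) simp
    then show ?thesis using J(2) by blast
  qed
  moreover have "M \<noteq> Walg \<Gamma>" using Wpow_inj[of 1 0] by (auto simp: M Walg_conv_Wpow)
  ultimately show "lie.maximal_lie_ideal M"
    unfolding lie.maximal_lie_ideal_def using M lie_ideal_Wpow by blast
qed

text \<open>For the inclusion from right to left, two brackets with the same index sum are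
  subtracted. Their terms of index j + 2 both have the factor j - 1 and cancel, while those of index
  j + 1 have the factors \<gamma> and \<gamma> - 2 h, which leaves 2 h.\<close>

lemma bracket_space_Wpow: "lie.bracket_space (Wpow \<Gamma> 1) (Wpow \<Gamma> n) = Wpow \<Gamma> (Suc n)"
proof
  show "lie.bracket_space (Wpow \<Gamma> 1) (Wpow \<Gamma> n) \<subseteq> Wpow \<Gamma> (Suc n)"
    unfolding lie.bracket_space_def
  proof (rule wvs.span_minimal)
    show "{wbracket a b |a b. a \<in> Wpow \<Gamma> 1 \<and> b \<in> Wpow \<Gamma> n} \<subseteq> Wpow \<Gamma> (Suc n)"
      using wbracket_in_Wpow[of _ 1 _ n] by auto
  qed (simp add: Wpow_def)
next
  let ?S = "lie.bracket_space (Wpow \<Gamma> 1) (Wpow \<Gamma> n)"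
  have S: "wvs.subspace ?S" by (simp add: lie.bracket_space_def)
  obtain h where h: "h \<in> \<Gamma>" "h \<noteq> 0" by (rule nonzero_memE)
  have "Lgen \<gamma> i \<in> ?S" if "\<gamma> \<in> \<Gamma>" "Suc n \<le> i" for \<gamma> i
  proof -
    obtain j where j: "i = Suc j" "n \<le> j" using \<open>Suc n \<le> i\<close> by (cases i) auto
    have mem: "wbracket (Lgen \<alpha> 1) (Lgen \<beta> j) \<in> ?S" if "\<alpha> \<in> \<Gamma>" "\<beta> \<in> \<Gamma>" for \<alpha> \<beta>
      unfolding lie.bracket_space_def
      by (rule wvs.span_base) (use that j(2) Lgen_in_Wpow in blast)
    have "wbracket (Lgen 0 1) (Lgen \<gamma> j) - wbracket (Lgen h 1) (Lgen (\<gamma> - h) j) \<in> ?S"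
      using mem[of 0 \<gamma>] mem[of h "\<gamma> - h"] that(1) h zero_mem diff_mem
      by (intro wvs.subspace_diff S) auto
    moreover have "wbracket (Lgen 0 1) (Lgen \<gamma> j) - wbracket (Lgen h 1) (Lgen (\<gamma> - h) j)
      = wscale (2 * h) (Lgen \<gamma> i)"
      by (rule poly_mapping_eqI)
        (simp add: wbracket_Lgen lookup_minus lookup_add lookup_Lgen j algebra_simps)
    ultimately have "wscale (2 * h) (Lgen \<gamma> i) \<in> ?S" by (simp only:)
    then have "wscale (inverse (2 * h)) (wscale (2 * h) (Lgen \<gamma> i)) \<in> ?S"
      by (rule wvs.subspace_scale[OF S])
    then show ?thesis using h by simp
  qed
  then show "Wpow \<Gamma> (Suc n) \<subseteq> ?S"
    unfolding Wpow_def[of \<Gamma> "Suc n"] by (intro wvs.span_minimal S) auto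
qed

lemma funpow_bracket_space_Wpow:
  "(lie.bracket_space (Wpow \<Gamma> 1) ^^ m) (Wpow \<Gamma> n) = Wpow \<Gamma> (m + n)"
  by (induction m) (simp_all add: bracket_space_Wpow del: One_nat_def)

end

theorem theorem2p1:
  fixes \<Gamma> :: "complex set"
  assumes "0 \<in> \<Gamma>"
    and "\<And>\<alpha> \<beta>. \<alpha> \<in> \<Gamma> \<Longrightarrow> \<beta> \<in> \<Gamma> \<Longrightarrow> \<alpha> + \<beta> \<in> \<Gamma>"
    and "\<And>\<alpha>. \<alpha> \<in> \<Gamma> \<Longrightarrow> - \<alpha> \<in> \<Gamma>"
    and "\<Gamma> \<noteq> {0}"
  shows "\<not> (\<exists>x\<in>Walg \<Gamma>. x \<noteq> 0 \<and> lie_algebra.ad_locally_finite wscale (Walg \<Gamma>) wbracket x)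
    \<and> \<not> lie_algebra.finitely_graded wscale (Walg \<Gamma>) wbracket TYPE('g)
    \<and> {I. lie_algebra.lie_ideal wscale (Walg \<Gamma>) wbracket I \<and> I \<noteq> {0}} = range (Wpow \<Gamma>)
    \<and> (\<forall>M. lie_algebra.maximal_lie_ideal wscale (Walg \<Gamma>) wbracket M \<longleftrightarrow> M = Wpow \<Gamma> 1)
    \<and> (\<forall>m n. m \<le> n \<longrightarrow>
          Wpow \<Gamma> n = (lie_algebra.bracket_space wscale wbracket (Wpow \<Gamma> 1) ^^ m) (Wpow \<Gamma> (n - m)))"
proof -
  interpret nontrivial_group \<Gamma>
    using assms by unfold_locales auto
  show ?thesis
  proof (intro conjI allI impI maximal_ideal_iff nonzero_ideals not_finitely_graded)
    show "\<not> (\<exists>x\<in>Walg \<Gamma>. x \<noteq> 0 \<and> lie.ad_locally_finite x)"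
      using not_ad_locally_finite by blast
    show "Wpow \<Gamma> n = (lie.bracket_space (Wpow \<Gamma> 1) ^^ m) (Wpow \<Gamma> (n - m))" if "m \<le> n" for m n
      using that by (simp add: funpow_bracket_space_Wpow del: One_nat_def)
  qed
qed

end
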